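(* Let $K$ be any field. Consider the Leibniz algebras over $K$ given by the following nonzero products of basis elements: $L_{11}$ with basis $\{e_1,e_2,e_3\}$ and $e_1e_3=e_1$, $e_2e_3=e_2$; $\mathcal L_4$ with basis $\{e_1,e_2\}$ and $e_1e_2=e_2e_2=e_1$; $N_4$ with basis $\{e_1,e_2,e_3\}$ and $e_1e_3=e_1$, $e_3e_3=e_1$; $L_{10}(0)$ with basis $\{e_1,e_2,e_3\}$ and $e_1e_3=e_2$, $e_2e_3=e_2$. Then $L_{11}$, $\mathcal L_4$, $N_4$ and $L_{10}(0)$ are PI-equivalent. Consequently, their relatively free algebras coincide: \[ \frac{\mathcal L\langle X\rangle}{T(L_{11})}=\frac{\mathcal L\langle X\rangle}{T(\mathcal L_4)}=\frac{\mathcal L\langle X\rangle}{T(N_4)}=\frac{\mathcal L\langle X\rangle}{T(L_{10}(0))}. \] More explicitly, let $\mathcal B_4\subseteq\mathcal L\langle X\rangle$ be the set of monomials of the form \[ x_{j_1}^{(m_1)}x_{j_2}^{(m_2)}\cdots x_{j_n}^{(m_n)},\qquad n\ge1,\ m_i\ge1,\ j_2<j_3<\cdots<j_n,\ j_1\ne j_k\text{ for all }k\ge2. \] If $K$ is infinite, then the images of the elements of $\mathcal B_4$ form a basis of $\mathcal L\langle X\rangle/T(L_{11})$. If $K$ is finite with $|K|=q$, the same conclusion holds for the elements of $\mathcal B_4$ satisfying the additional restrictions $1\le m_1\le q$ and $1\le m_i<q$ for $i\ge2$. Moreover, $c_n(L_{11})=n$ for all $n\ge1$, and hence $\exp(L_{11})=1$.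 The same conclusions hold for $N_4$, $\mathcal L_4$ and $L_{10}(0)$.
   Context: A (right) Leibniz algebra over $K$ is a $K$-algebra satisfying $x(yz)=(xy)z-(xz)y$. $\mathcal L\langle X\rangle$ is the free Leibniz algebra over $K$ on $X=\{x_1,x_2,\dots\}$; $T(L)$ is the ideal of polynomials vanishing under all substitutions of elements of $L$. Two algebras $A,B$ are PI-equivalent if $T(A)=T(B)$. Products without brackets are left-normed, and $x^{(m)}$ means $m$ consecutive occurrences of $x$ in a left-normed product; thus $x_{j_1}^{(m_1)}x_{j_2}^{(m_2)}\cdots$ is the left-normed product of $m_1$ copies of $x_{j_1}$, then $m_2$ copies of $x_{j_2}$, etc. $P_n\subset\mathcal L\langle X\rangle$ is the space of multilinear polynomials in $x_1,\dots,x_n$, $c_n(L)=\dim_K P_n/(P_n\cap T(L))$, and $\exp(L)=\lim_{n\to\infty}\sqrt[n]{c_n(L)}$. Products of basis elements not listed are zero. *)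

theory Defs
  imports
    "HOL-Analysis.Cartesian_Space"
    "HOL-Library.Poly_Mapping"
    "HOL-Library.Set_Algebras"
begin

section \<open>Algebras over a field\<close>

text \<open>A not necessarily associative algebra: the additive group is that of the type
  \<^typ>\<open>'a\<close>, the field is \<^typ>\<open>'k\<close>.\<close>

record ('k, 'a) algebra =
  scal :: "'k \<Rightarrow> 'a \<Rightarrow> 'a"
  prd :: "'a \<Rightarrow> 'a \<Rightarrow> 'a"

locale k_algebra = vector_space "scal L"
  for L :: "('k::field, 'a::ab_group_add) algebra" +
  assumes prd_add_left: "prd L (x + y) z = prd L x z + prd L y z"
    and prd_add_right: "prd L x (y + z) = prd L x y + prd L x z"
    and prd_scal_left: "prd L (scal L c x) y = scal L c (prd L x y)"
    and prd_scal_right: "prd L x (scal L c y) = scal L c (prd L x y)"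

locale leibniz_algebra = k_algebra L for L :: "('k::field, 'a::ab_group_add) algebra" +
  assumes leibniz: "prd L x (prd L y z) = prd L (prd L x y) z - prd L (prd L x z) y"


section \<open>The free Leibniz algebra\<close>

text \<open>Nonassociative words in the letters \<open>x\<^sub>0, x\<^sub>1, \<dots>\<close>, and the free
  nonassociative algebra, which has these words as a basis. Letters are numbered from 0,
  so that \<open>x\<^sub>0, \<dots>, x\<^sub>n\<^sub>-\<^sub>1\<close> are the first n of them.\<close>

datatype magma = Letter nat | Node magma magma

primrec leaves :: "magma \<Rightarrow> nat list" where
  "leaves (Letter i) = [i]"
| "leaves (Node u v) = leaves u @ leaves v"

type_synonym 'k na_poly = "magma \<Rightarrow>\<^sub>0 'k"

definition na_scal :: "'k::field \<Rightarrow> 'k na_poly \<Rightarrow> 'k na_poly" where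
  "na_scal c p = Poly_Mapping.map ((*) c) p"

definition na_prd :: "'k::field na_poly \<Rightarrow> 'k na_poly \<Rightarrow> 'k na_poly" where
  "na_prd p q = (\<Sum>u\<in>Poly_Mapping.keys p. \<Sum>v\<in>Poly_Mapping.keys q.
     Poly_Mapping.single (Node u v) (Poly_Mapping.lookup p u * Poly_Mapping.lookup q v))"

lemma lookup_na_scal [simp]:
  "Poly_Mapping.lookup (na_scal c p) w = c * Poly_Mapping.lookup p w"
  by (simp add: na_scal_def map.rep_eq when_def)

lemma lookup_na_prd_Letter [simp]: "Poly_Mapping.lookup (na_prd p q) (Letter i) = 0"
  by (simp add: na_prd_def lookup_sum lookup_single)

lemma lookup_na_prd_Node [simp]:
  "Poly_Mapping.lookup (na_prd p q) (Node u v)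
    = Poly_Mapping.lookup p u * Poly_Mapping.lookup q v"
proof -
  have "Poly_Mapping.lookup (na_prd p q) (Node u v)
    = (\<Sum>u'\<in>Poly_Mapping.keys p. \<Sum>v'\<in>Poly_Mapping.keys q. if u' = u then if v' = v then
        Poly_Mapping.lookup p u' * Poly_Mapping.lookup q v' else 0 else 0)"
    by (simp add: na_prd_def lookup_sum lookup_single when_def)
       (intro sum.cong refl, auto)
  also have "\<dots> = (\<Sum>u'\<in>Poly_Mapping.keys p. if u' = u then \<Sum>v'\<in>Poly_Mapping.keys q. if v' = v then
        Poly_Mapping.lookup p u' * Poly_Mapping.lookup q v' else 0 else 0)"
    by (intro sum.cong refl) auto
  also have "\<dots> = Poly_Mapping.lookup p u * Poly_Mapping.lookup q v"
    by (simp add: sum.delta in_keys_iff)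
  finally show ?thesis .
qed

lemma na_prd_add_left: "na_prd (p + p') q = na_prd p q + na_prd p' q"
  and na_prd_add_right: "na_prd p (q + q') = na_prd p q + na_prd p q'"
  and na_prd_diff_left: "na_prd (p - p') q = na_prd p q - na_prd p' q"
  and na_prd_diff_right: "na_prd p (q - q') = na_prd p q - na_prd p q'"
  and na_prd_scal_left: "na_prd (na_scal c p) q = na_scal c (na_prd p q)"
  and na_prd_scal_right: "na_prd p (na_scal c q) = na_scal c (na_prd p q)"
  by (rule poly_mapping_eqI, rename_tac w, case_tac w;
      simp add: lookup_add lookup_minus algebra_simps)+

lemma na_scal_add_right: "na_scal c (p + q) = na_scal c p + na_scal c q"
  and na_scal_diff_right: "na_scal c (p - q) = na_scal c p - na_scal c q"
  and na_scal_add_left: "na_scal (c + d) p = na_scal c p + na_scal d p"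
  and na_scal_scal: "na_scal c (na_scal d p) = na_scal (c * d) p"
  and na_scal_one: "na_scal 1 p = p"
  by (rule poly_mapping_eqI; simp add: lookup_add lookup_minus algebra_simps)+

text \<open>The two-sided ideal generated by all \<open>f(gh) - (fg)h + (fh)g\<close>.\<close>

inductive_set leibniz_ideal :: "'k::field na_poly set" where
  gen: "na_prd f (na_prd g h) - na_prd (na_prd f g) h + na_prd (na_prd f h) g \<in> leibniz_ideal"
| zero: "0 \<in> leibniz_ideal"
| add: "p \<in> leibniz_ideal \<Longrightarrow> q \<in> leibniz_ideal \<Longrightarrow> p + q \<in> leibniz_ideal"
| scal: "p \<in> leibniz_ideal \<Longrightarrow> na_scal c p \<in> leibniz_ideal"
| prd_left: "p \<in> leibniz_ideal \<Longrightarrow> na_prd f p \<in> leibniz_ideal"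
| prd_right: "p \<in> leibniz_ideal \<Longrightarrow> na_prd p f \<in> leibniz_ideal"

lemma leibniz_ideal_uminus:
  assumes "p \<in> leibniz_ideal" shows "- p \<in> leibniz_ideal"
proof -
  have "na_scal (- 1) p = - p"
    by (rule poly_mapping_eqI) simp
  with leibniz_ideal.scal[OF assms, of "- 1"] show ?thesis by simp
qed

lemma leibniz_ideal_minus_commute: "p - q \<in> leibniz_ideal \<Longrightarrow> q - p \<in> leibniz_ideal"
  using leibniz_ideal_uminus[of "p - q"] by simp

lemma leibniz_ideal_diff_trans:
  assumes "p - q \<in> leibniz_ideal" "q - r \<in> leibniz_ideal"
  shows "p - r \<in> leibniz_ideal"
  using leibniz_ideal.add[OF assms] by simp

quotient_type (overloaded) 'k free_leibniz =
  "'k::field na_poly" / "\<lambda>p q. p - q \<in> leibniz_ideal"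
proof (rule equivpI)
  show "reflp (\<lambda>p q :: 'k na_poly. p - q \<in> leibniz_ideal)"
    by (rule reflpI) (simp add: leibniz_ideal.zero)
  show "symp (\<lambda>p q :: 'k na_poly. p - q \<in> leibniz_ideal)"
    by (rule sympI) (rule leibniz_ideal_minus_commute)
  show "transp (\<lambda>p q :: 'k na_poly. p - q \<in> leibniz_ideal)"
    by (rule transpI) (rule leibniz_ideal_diff_trans)
qed

instantiation free_leibniz :: (field) ab_group_add
begin

lift_definition zero_free_leibniz :: "'a free_leibniz" is 0 .

lift_definition plus_free_leibniz :: "'a free_leibniz \<Rightarrow> 'a free_leibniz \<Rightarrow> 'a free_leibniz"
  is "(+)"
  by (simp only: add_diff_add leibniz_ideal.add)

lift_definition uminus_free_leibniz :: "'a free_leibniz \<Rightarrow> 'a free_leibniz" is uminus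
  by (simp only: minus_diff_minus leibniz_ideal_uminus)

definition minus_free_leibniz :: "'a free_leibniz \<Rightarrow> 'a free_leibniz \<Rightarrow> 'a free_leibniz"
  where "minus_free_leibniz f g = f + (- g)"

instance
proof
  fix f g h :: "'a free_leibniz"
  show "f + g + h = f + (g + h)" by transfer (simp add: add.assoc leibniz_ideal.zero)
  show "f + g = g + f" by transfer (simp add: add.commute leibniz_ideal.zero)
  show "0 + f = f" by transfer (simp add: leibniz_ideal.zero)
  show "- f + f = 0" by transfer (simp add: leibniz_ideal.zero)
  show "f - g = f + - g" by (simp add: minus_free_leibniz_def)
qed

end

instantiation free_leibniz :: (field) times
begin

lift_definition times_free_leibniz :: "'a free_leibniz \<Rightarrow> 'a free_leibniz \<Rightarrow> 'a free_leibniz"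
  is na_prd
proof -
  fix p p' q q' :: "'a na_poly"
  assume "p - p' \<in> leibniz_ideal" "q - q' \<in> leibniz_ideal"
  then have "na_prd (p - p') q + na_prd p' (q - q') \<in> leibniz_ideal"
    by (intro leibniz_ideal.add leibniz_ideal.prd_left leibniz_ideal.prd_right)
  then show "na_prd p q - na_prd p' q' \<in> leibniz_ideal"
    by (simp add: na_prd_diff_left na_prd_diff_right)
qed

instance ..

end

lift_definition fl_scal :: "'k::field \<Rightarrow> 'k free_leibniz \<Rightarrow> 'k free_leibniz" is na_scal
  by (metis leibniz_ideal.scal na_scal_diff_right)

lift_definition var :: "nat \<Rightarrow> 'k::field free_leibniz"
  is "\<lambda>i. Poly_Mapping.single (Letter i) 1" .

definition free_leibniz_algebra :: "('k::field, 'k free_leibniz) algebra" where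
  "free_leibniz_algebra = \<lparr>scal = fl_scal, prd = (*)\<rparr>"

lemma leibniz_algebra_free_leibniz: "leibniz_algebra free_leibniz_algebra"
proof -
  have eq: "na_prd f (na_prd g h) - (na_prd (na_prd f g) h - na_prd (na_prd f h) g)
      \<in> leibniz_ideal" for f g h :: "'k::field na_poly"
    using leibniz_ideal.gen[of f g h] by (simp add: algebra_simps)
  have fl_diff: "abs_free_leibniz p - abs_free_leibniz q = abs_free_leibniz (p - q)"
    for p q :: "'k::field na_poly"
    by (simp add: minus_free_leibniz_def uminus_free_leibniz.abs_eq plus_free_leibniz.abs_eq)
  have leib: "f * (g * h) = (f * g) * h - (f * h) * g" for f g h :: "'k::field free_leibniz"
    by (induction f rule: free_leibniz.abs_induct, induction g rule: free_leibniz.abs_induct,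
        induction h rule: free_leibniz.abs_induct)
       (simp add: times_free_leibniz.abs_eq fl_diff free_leibniz.abs_eq_iff eq)
  show ?thesis
    by unfold_locales
      (simp_all add: free_leibniz_algebra_def leib,
        (transfer, simp add: leibniz_ideal.zero na_scal_add_right na_scal_add_left na_scal_scal
          na_scal_one na_prd_add_left na_prd_add_right na_prd_scal_left na_prd_scal_right)+)
qed


section \<open>Polynomial identities\<close>

primrec word_eval :: "('k::field, 'a::ab_group_add) algebra \<Rightarrow> (nat \<Rightarrow> 'a) \<Rightarrow> magma \<Rightarrow> 'a" where
  "word_eval L \<rho> (Letter i) = \<rho> i"
| "word_eval L \<rho> (Node u v) = prd L (word_eval L \<rho> u) (word_eval L \<rho> v)"

definition na_eval :: "('k::field, 'a::ab_group_add) algebra \<Rightarrow> (nat \<Rightarrow> 'a) \<Rightarrow> 'k na_poly \<Rightarrow> 'a" where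
  "na_eval L \<rho> p = (\<Sum>w\<in>Poly_Mapping.keys p. scal L (Poly_Mapping.lookup p w) (word_eval L \<rho> w))"

text \<open>The value of f under the substitution \<open>x\<^sub>i \<mapsto> \<rho> i\<close>, computed on a
  representative. If L is a Leibniz algebra, it does not depend on the representative
  and is a homomorphism in f (lemmas \<open>eval_at_abs\<close> to \<open>eval_at_prd\<close>).\<close>

definition eval_at :: "('k::field, 'a::ab_group_add) algebra \<Rightarrow> (nat \<Rightarrow> 'a) \<Rightarrow> 'k free_leibniz \<Rightarrow> 'a" where
  "eval_at L \<rho> f = na_eval L \<rho> (rep_free_leibniz f)"

definition T_ideal :: "('k::field, 'a::ab_group_add) algebra \<Rightarrow> 'k free_leibniz set" where
  "T_ideal L = {f. \<forall>\<rho>. eval_at L \<rho> f = 0}"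

definition pi_equivalent ::
  "('k::field, 'a::ab_group_add) algebra \<Rightarrow> ('k, 'b::ab_group_add) algebra \<Rightarrow> bool" where
  "pi_equivalent A B \<longleftrightarrow> T_ideal A = T_ideal B"

context k_algebra
begin

lemma na_eval_superset:
  assumes "finite S" "Poly_Mapping.keys p \<subseteq> S"
  shows "na_eval L \<rho> p = (\<Sum>w\<in>S. scal L (Poly_Mapping.lookup p w) (word_eval L \<rho> w))"
  unfolding na_eval_def
  by (rule sum.mono_neutral_left) (use assms in \<open>auto simp: in_keys_iff\<close>)

lemma na_eval_zero [simp]: "na_eval L \<rho> 0 = 0"
  by (simp add: na_eval_def)

lemma na_eval_single [simp]:
  "na_eval L \<rho> (Poly_Mapping.single w c) = scal L c (word_eval L \<rho> w)"
  by (subst na_eval_superset[of "{w}"]) auto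

lemma na_eval_add: "na_eval L \<rho> (p + q) = na_eval L \<rho> p + na_eval L \<rho> q"
proof -
  let ?S = "Poly_Mapping.keys p \<union> Poly_Mapping.keys q"
  have "finite ?S" "Poly_Mapping.keys (p + q) \<subseteq> ?S" 
    using keys_add[of p q] by auto
  then show ?thesis
    by (simp add: na_eval_superset[of ?S] lookup_add scale_left_distrib sum.distrib)
qed

lemma na_eval_scal: "na_eval L \<rho> (na_scal c p) = scal L c (na_eval L \<rho> p)"
proof -
  have "Poly_Mapping.keys (na_scal c p) \<subseteq> Poly_Mapping.keys p" by (auto simp: in_keys_iff)
  then show ?thesis
    by (simp add: na_eval_superset[of "Poly_Mapping.keys p"] scale_sum_right)
qed

lemma na_eval_diff: "na_eval L \<rho> (p - q) = na_eval L \<rho> p - na_eval L \<rho> q"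
  using na_eval_add[of \<rho> "p - q" q] by simp

lemma na_eval_sum: "na_eval L \<rho> (sum f S) = (\<Sum>s\<in>S. na_eval L \<rho> (f s))"
  by (induction S rule: infinite_finite_induct) (simp_all add: na_eval_add)

lemma prd_zero_left [simp]: "prd L 0 b = 0" and prd_zero_right [simp]: "prd L a 0 = 0"
  using prd_add_left[of 0 0 b] prd_add_right[of a 0 0] by simp_all

lemma prd_sum_left: "prd L (sum f S) b = (\<Sum>s\<in>S. prd L (f s) b)"
  by (induction S rule: infinite_finite_induct) (simp_all add: prd_add_left)

lemma prd_sum_right: "prd L a (sum f S) = (\<Sum>s\<in>S. prd L a (f s))"
  by (induction S rule: infinite_finite_induct) (simp_all add: prd_add_right)

lemma na_eval_prd: "na_eval L \<rho> (na_prd p q) = prd L (na_eval L \<rho> p) (na_eval L \<rho> q)"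
  by (simp add: na_prd_def na_eval_sum na_eval_def[of L \<rho> p] na_eval_def[of L \<rho> q]
      prd_sum_left prd_sum_right prd_scal_left prd_scal_right scale_sum_right)
    (subst sum.swap, simp add: mult.commute)

end

context leibniz_algebra
begin

lemma na_eval_leibniz_ideal: "p \<in> leibniz_ideal \<Longrightarrow> na_eval L \<rho> p = 0"
  by (induction rule: leibniz_ideal.induct)
    (simp_all add: na_eval_add na_eval_diff na_eval_scal na_eval_prd leibniz)

lemma eval_at_abs: "eval_at L \<rho> (abs_free_leibniz p) = na_eval L \<rho> p"
proof -
  have "rep_free_leibniz (abs_free_leibniz p) - p \<in> leibniz_ideal"
    by (metis Quotient3_free_leibniz Quotient3_abs_rep free_leibniz.abs_eq_iff)
  from na_eval_leibniz_ideal[OF this] show ?thesis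
    by (simp add: eval_at_def na_eval_diff)
qed

lemma eval_at_var: "eval_at L \<rho> (var i) = \<rho> i"
  by (simp add: var.abs_eq eval_at_abs)

lemma eval_at_add: "eval_at L \<rho> (f + g) = eval_at L \<rho> f + eval_at L \<rho> g"
  by (induction f rule: free_leibniz.abs_induct, induction g rule: free_leibniz.abs_induct)
    (simp add: plus_free_leibniz.abs_eq eval_at_abs na_eval_add)

lemma eval_at_scal: "eval_at L \<rho> (fl_scal c f) = scal L c (eval_at L \<rho> f)"
  by (induction f rule: free_leibniz.abs_induct)
    (simp add: fl_scal.abs_eq eval_at_abs na_eval_scal)

lemma eval_at_prd: "eval_at L \<rho> (f * g) = prd L (eval_at L \<rho> f) (eval_at L \<rho> g)"
  by (induction f rule: free_leibniz.abs_induct, induction g rule: free_leibniz.abs_induct)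
    (simp add: times_free_leibniz.abs_eq eval_at_abs na_eval_prd)

end


section \<open>Quotient spaces\<close>

text \<open>Vector spaces and algebras given by a carrier set. They are needed because a quotient
  by \<open>T_ideal L\<close> depends on L and hence is not a type.\<close>

record ('k, 'v) carrier_space =
  carrier :: "'v set"
  vadd :: "'v \<Rightarrow> 'v \<Rightarrow> 'v"
  vzero :: 'v
  vscal :: "'k \<Rightarrow> 'v \<Rightarrow> 'v"

record ('k, 'v) carrier_algebra = "('k, 'v) carrier_space" +
  vprd :: "'v \<Rightarrow> 'v \<Rightarrow> 'v"

definition subspace_in :: "('k, 'v, 'm) carrier_space_scheme \<Rightarrow> 'v set \<Rightarrow> bool" where
  "subspace_in V S \<longleftrightarrow> S \<subseteq> carrier V \<and> vzero V \<in> S \<and>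
     (\<forall>a\<in>S. \<forall>b\<in>S. vadd V a b \<in> S) \<and> (\<forall>c. \<forall>a\<in>S. vscal V c a \<in> S)"

definition span_in :: "('k, 'v, 'm) carrier_space_scheme \<Rightarrow> 'v set \<Rightarrow> 'v set" where
  "span_in V B = \<Inter>{S. subspace_in V S \<and> B \<subseteq> S}"

definition independent_in :: "('k, 'v, 'm) carrier_space_scheme \<Rightarrow> 'v set \<Rightarrow> bool" where
  "independent_in V B \<longleftrightarrow> (\<forall>b\<in>B. b \<notin> span_in V (B - {b}))"

definition basis_in :: "('k, 'v, 'm) carrier_space_scheme \<Rightarrow> 'v set \<Rightarrow> bool" where
  "basis_in V B \<longleftrightarrow> B \<subseteq> carrier V \<and> independent_in V B \<and> span_in V B = carrier V"

text \<open>As usual in the library, infinite-dimensional spaces get the value 0.\<close>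

definition dim_in :: "('k, 'v, 'm) carrier_space_scheme \<Rightarrow> nat" where
  "dim_in V = card (SOME B. basis_in V B)"

text \<open>The quotient \<open>U / W\<close> of subspaces \<open>W \<subseteq> U\<close>; its elements are the cosets
  \<open>u + W\<close>. The sum of two cosets is their elementwise sum; W is added to the elementwise
  multiple only because of the scalar 0.\<close>

definition quotient_space ::
  "('k \<Rightarrow> 'a \<Rightarrow> 'a::ab_group_add) \<Rightarrow> 'a set \<Rightarrow> 'a set \<Rightarrow> ('k, 'a set) carrier_space" where
  "quotient_space s U W =
     \<lparr>carrier = (\<lambda>u. u +o W) ` U, vadd = (+), vzero = W, vscal = (\<lambda>c A. s c ` A + W)\<rparr>"

definition relatively_free ::
  "('k::field, 'a::ab_group_add) algebra \<Rightarrow> ('k, 'k free_leibniz set) carrier_algebra" where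
  "relatively_free L = carrier_space.extend (quotient_space fl_scal UNIV (T_ideal L))
     \<lparr>vprd = (\<lambda>A B. A * B + T_ideal L)\<rparr>"

abbreviation image_in_relfree ::
  "('k::field, 'a::ab_group_add) algebra \<Rightarrow> 'k free_leibniz \<Rightarrow> 'k free_leibniz set" where
  "image_in_relfree L f \<equiv> f +o T_ideal L"

text \<open>The images of the members of B are pairwise distinct and form a basis.\<close>

definition images_form_basis ::
  "('k::field, 'a::ab_group_add) algebra \<Rightarrow> 'k free_leibniz set \<Rightarrow> bool" where
  "images_form_basis L B \<longleftrightarrow>
     inj_on (image_in_relfree L) B \<and> basis_in (relatively_free L) (image_in_relfree L ` B)"


section \<open>Codimensions\<close>

text \<open>The class of a nonassociative word in the free Leibniz algebra.\<close>

primrec monomial :: "magma \<Rightarrow> 'k::field free_leibniz" where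
  "monomial (Letter i) = var i"
| "monomial (Node u v) = monomial u * monomial v"

definition multilinear :: "nat \<Rightarrow> 'k::field free_leibniz set" where
  "multilinear n = module.span fl_scal (monomial ` {w. distinct (leaves w) \<and> set (leaves w) = {..<n}})"

definition codim :: "('k::field, 'a::ab_group_add) algebra \<Rightarrow> nat \<Rightarrow> nat" where
  "codim L n = dim_in (quotient_space fl_scal (multilinear n) (multilinear n \<inter> T_ideal L))"

definition has_exponent :: "('k::field, 'a::ab_group_add) algebra \<Rightarrow> real \<Rightarrow> bool" where
  "has_exponent L e \<longleftrightarrow> (\<lambda>n. root n (real (codim L n))) \<longlonglongrightarrow> e"


section \<open>The monomials\<close>

fun left_normed :: "'a::times list \<Rightarrow> 'a" where
  "left_normed (a # as) = foldl (*) a as"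

text \<open>The left-normed product of \<open>m 1\<close> copies of \<open>var (j 1)\<close>, then \<open>m 2\<close> copies of
  \<open>var (j 2)\<close>, and so on up to n.\<close>

definition power_monomial :: "nat \<Rightarrow> (nat \<Rightarrow> nat) \<Rightarrow> (nat \<Rightarrow> nat) \<Rightarrow> 'k::field free_leibniz" where
  "power_monomial n j m =
     left_normed (concat (map (\<lambda>i. replicate (m i) (var (j i))) [1..<Suc n]))"

definition B4_index :: "nat \<Rightarrow> (nat \<Rightarrow> nat) \<Rightarrow> (nat \<Rightarrow> nat) \<Rightarrow> bool" where
  "B4_index n j m \<longleftrightarrow> 1 \<le> n \<and> (\<forall>i\<in>{1..n}. 1 \<le> m i) \<and>
     strict_mono_on {2..n} j \<and> (\<forall>k\<in>{2..n}. j 1 \<noteq> j k)"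

definition B4 :: "'k::field free_leibniz set" where
  "B4 = {power_monomial n j m | n j m. B4_index n j m}"

definition B4_restricted :: "nat \<Rightarrow> 'k::field free_leibniz set" where
  "B4_restricted q = {power_monomial n j m | n j m.
     B4_index n j m \<and> m 1 \<le> q \<and> (\<forall>i\<in>{2..n}. m i < q)}"


section \<open>The four algebras\<close>

text \<open>The bilinear product on column vectors whose value on the standard basis vectors
  \<open>e\<^sub>i, e\<^sub>j\<close> is \<open>t i j\<close>. (In the index type \<^typ>\<open>3\<close>, the numeral 3 denotes the
  remaining element besides 1 and 2; similarly for \<^typ>\<open>2\<close>.)\<close>

definition table_algebra :: "('n \<Rightarrow> 'n \<Rightarrow> 'k ^ 'n) \<Rightarrow> ('k::field, 'k ^ 'n::finite) algebra" where
  "table_algebra t = \<lparr>scal = (*s), prd = (\<lambda>a b. \<Sum>i\<in>UNIV. \<Sum>j\<in>UNIV. (a $ i * b $ j) *s t i j)\<rparr>"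

abbreviation bv :: "'n \<Rightarrow> 'k::field ^ 'n::finite" where
  "bv i \<equiv> axis i 1"

definition L11 :: "('k::field, 'k ^ 3) algebra" where
  "L11 = table_algebra (\<lambda>i j.
     if (i, j) = (1, 3) then bv 1 else if (i, j) = (2, 3) then bv 2 else 0)"

definition LL4 :: "('k::field, 'k ^ 2) algebra" where
  "LL4 = table_algebra (\<lambda>i j.
     if (i, j) = (1, 2) then bv 1 else if (i, j) = (2, 2) then bv 1 else 0)"

definition N4 :: "('k::field, 'k ^ 3) algebra" where
  "N4 = table_algebra (\<lambda>i j.
     if (i, j) = (1, 3) then bv 1 else if (i, j) = (3, 3) then bv 1 else 0)"

definition L10_0 :: "('k::field, 'k ^ 3) algebra" where
  "L10_0 = table_algebra (\<lambda>i j.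
     if (i, j) = (1, 3) then bv 2 else if (i, j) = (2, 3) then bv 2 else 0)"

lemma k_algebra_table: "k_algebra (table_algebra t)"
  by unfold_locales
    (auto simp: table_algebra_def vec_eq_iff algebra_simps sum.distrib sum_distrib_left)

lemma prd_table_basis: "prd (table_algebra t) (bv i) (bv j) = t i j"
proof -
  have "prd (table_algebra t) (bv i) (bv j)
      = (\<Sum>i'\<in>UNIV. \<Sum>j'\<in>UNIV. if i' = i then if j' = j then t i' j' else 0 else 0)"
    by (auto simp: table_algebra_def axis_def intro!: sum.cong)
  also have "\<dots> = (\<Sum>i'\<in>UNIV. if i' = i then \<Sum>j'\<in>UNIV. if j' = j then t i' j' else 0 else 0)"
    by (intro sum.cong refl) auto
  finally show ?thesis by (simp add: sum.delta)
qed

lemma leibniz_algebra_L11: "leibniz_algebra L11"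
  and leibniz_algebra_LL4: "leibniz_algebra LL4"
  and leibniz_algebra_N4: "leibniz_algebra N4"
  and leibniz_algebra_L10_0: "leibniz_algebra L10_0"
  unfolding leibniz_algebra_def leibniz_algebra_axioms_def
  unfolding L11_def LL4_def N4_def L10_0_def
  by (auto simp: k_algebra_table)
     (auto simp: table_algebra_def vec_eq_iff forall_3 forall_2 sum_3 sum_2 axis_def algebra_simps)

end

theory Submission
  imports Defs "HOL-Computational_Algebra.Polynomial" "HOL-Library.Multiset"
    "HOL-Library.Function_Algebras"
begin

text \<open>In each of the four algebras the product is \<open>xy = l(y) P(x)\<close> for a linear projection P and
  a linear functional l that vanishes on the image of P. Hence in degree at least 2 only left-normed monomials
  \<open>x\<^sub>i y\<^sub>1 \<dots> y\<^sub>r\<close> have nonzero values, namely \<open>l(y\<^sub>1) \<dots> l(y\<^sub>r) P(x\<^sub>i)\<close>, and these do not depend on the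
  order of the \<open>y\<^sub>k\<close>. So f corresponds to a family of polynomials \<open>f\<^sub>i(t)\<close>, the coefficients of the
  \<open>P(x\<^sub>i)\<close>, and f is an identity if and only if every \<open>f\<^sub>i\<close> vanishes as a function on K. This condition
  no longer involves the algebra. It identifies the relatively free algebra with a space of families
  of polynomial functions, where the given monomials become the ordinary monomials, reduced by
  \<open>t\<^sup>q = t\<close> if K has q elements.\<close>

section \<open>Quotient spaces as images of linear maps\<close>

text \<open>Only closure of the carrier is assumed of \<open>V\<close>. An injective map that
  respects its operations embeds \<open>V\<close> into a vector space on a type, where spans,
  independence and dimension can be computed.\<close>

locale coordinates = vector_space sc for sc :: "'k::field \<Rightarrow> 'b::ab_group_add \<Rightarrow> 'b" +
  fixes V :: "('k, 'v, 'm) carrier_space_scheme" and \<psi> :: "'v \<Rightarrow> 'b"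
  assumes inj: "inj_on \<psi> (carrier V)"
    and subspace_carrier: "subspace_in V (carrier V)"
    and vadd: "A \<in> carrier V \<Longrightarrow> B \<in> carrier V \<Longrightarrow> \<psi> (vadd V A B) = \<psi> A + \<psi> B"
    and vzero: "\<psi> (vzero V) = 0"
    and vscal: "A \<in> carrier V \<Longrightarrow> \<psi> (vscal V c A) = sc c (\<psi> A)"
begin

lemma subspace_image:
  assumes "subspace_in V S"
  shows "subspace (\<psi> ` S)"
proof (rule subspaceI)
  have S: "S \<subseteq> carrier V" using assms by (simp add: subspace_in_def)
  show "0 \<in> \<psi> ` S" using assms vzero by (force simp: subspace_in_def)
  show "x + y \<in> \<psi> ` S" if "x \<in> \<psi> ` S" "y \<in> \<psi> ` S" for x y
  proof -
    from that obtain a b where "a \<in> S" "b \<in> S" "x = \<psi> a" "y = \<psi> b" by blast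
    then have "x + y = \<psi> (vadd V a b)" "vadd V a b \<in> S"
      using S assms by (auto simp: subspace_in_def vadd subset_iff)
    then show ?thesis by blast
  qed
  show "sc c x \<in> \<psi> ` S" if "x \<in> \<psi> ` S" for c x
  proof -
    from that obtain a where "a \<in> S" "x = \<psi> a" by blast
    then have "sc c x = \<psi> (vscal V c a)" "vscal V c a \<in> S"
      using S assms by (auto simp: subspace_in_def vscal subset_iff)
    then show ?thesis by blast
  qed
qed

lemma span_in_subset_carrier: "B \<subseteq> carrier V \<Longrightarrow> span_in V B \<subseteq> carrier V"
  using subspace_carrier by (auto simp: span_in_def)

text \<open>The carrier elements that \<psi> sends into the span of the image form a subspace
  containing \<open>B\<close>; this gives one inclusion. For the other, the image of any subspace
  containing \<open>B\<close> is a subspace, so it contains that span.\<close>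

lemma image_span_in:
  assumes B: "B \<subseteq> carrier V"
  shows "\<psi> ` span_in V B = span (\<psi> ` B)"
proof (intro subset_antisym subsetI)
  let ?S = "{A \<in> carrier V. \<psi> A \<in> span (\<psi> ` B)}"
  have "subspace_in V ?S"
    using subspace_carrier vadd vzero vscal
    by (auto simp: subspace_in_def span_zero span_add span_scale)
  moreover have "B \<subseteq> ?S" using B by (auto intro: span_base)
  ultimately have "span_in V B \<subseteq> ?S" by (auto simp: span_in_def)
  then show "x \<in> span (\<psi> ` B)" if "x \<in> \<psi> ` span_in V B" for x using that by blast
next
  fix x assume x: "x \<in> span (\<psi> ` B)"
  have *: "x \<in> \<psi> ` S" if "subspace_in V S" "B \<subseteq> S" for S
    using x span_minimal[OF _ subspace_image[OF that(1)], of "\<psi> ` B"] that(2) by blast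
  from *[OF subspace_carrier B] obtain a where a: "a \<in> carrier V" "x = \<psi> a" by blast
  \<comment> \<open>\<open>span_in\<close> is an intersection, and each \<open>S\<close> could
    supply its own preimage of \<open>x\<close>. Injectivity makes all of them equal to
    \<open>a\<close>.\<close>
  have "a \<in> S" if "subspace_in V S" "B \<subseteq> S" for S
  proof -
    from *[OF that] obtain b where "b \<in> S" "x = \<psi> b" by blast
    with a inj that(1) show ?thesis by (auto simp: subspace_in_def inj_on_def)
  qed
  then show "x \<in> \<psi> ` span_in V B" using a by (auto simp: span_in_def)
qed

lemma basis_in_iff:
  assumes B: "B \<subseteq> carrier V"
  shows "basis_in V B \<longleftrightarrow> independent (\<psi> ` B) \<and> span (\<psi> ` B) = \<psi> ` carrier V"
proof -
  have "b \<in> span_in V (B - {b}) \<longleftrightarrow> \<psi> b \<in> span (\<psi> ` B - {\<psi> b})" if b: "b \<in> B" for b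
  proof -
    have "\<psi> ` B - {\<psi> b} = \<psi> ` (B - {b})"
      using b B inj by (auto simp: inj_on_def)
    then have "span (\<psi> ` B - {\<psi> b}) = \<psi> ` span_in V (B - {b})"
      using image_span_in[of "B - {b}"] B by (simp add: Diff_subset[THEN subset_trans])
    then show ?thesis
      using inj_on_image_mem_iff[OF inj, of b "span_in V (B - {b})"] span_in_subset_carrier[of "B - {b}"] b B
      by auto
  qed
  then have "independent_in V B \<longleftrightarrow> independent (\<psi> ` B)"
    by (auto simp: independent_in_def dependent_def)
  moreover have "span_in V B = carrier V \<longleftrightarrow> span (\<psi> ` B) = \<psi> ` carrier V"
    using inj_on_image_eq_iff[OF inj span_in_subset_carrier[OF B]] image_span_in[OF B] by auto
  ultimately show ?thesis using B by (auto simp: basis_in_def)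
qed

text \<open>\<open>dim_in\<close> picks a basis by \<open>SOME\<close>, so one has to exist first: a
  basis of the image is pulled back along \<psi>. In infinite dimension both sides are 0.\<close>

lemma dim_in_eq: "dim_in V = dim (\<psi> ` carrier V)"
proof -
  obtain C where C: "C \<subseteq> \<psi> ` carrier V" "independent C" "\<psi> ` carrier V \<subseteq> span C"
    using maximal_independent_subset by metis
  from C(1) obtain B where B: "B \<subseteq> carrier V" "C = \<psi> ` B"
    by (auto simp: subset_image_iff)
  have "span C = \<psi> ` carrier V"
    using C span_minimal[OF C(1) subspace_image[OF subspace_carrier]] by auto
  then have "basis_in V B" using basis_in_iff[OF B(1)] B(2) C by auto
  then have some: "basis_in V (SOME B. basis_in V B)" by (rule someI)
  define D where "D = (SOME B. basis_in V B)"
  have D: "basis_in V D" using some by (simp add: D_def)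
  then have DV: "D \<subseteq> carrier V" by (simp add: basis_in_def)
  with D have "independent (\<psi> ` D)" "span (\<psi> ` D) = \<psi> ` carrier V" by (simp_all add: basis_in_iff)
  then have "dim (\<psi> ` carrier V) = card (\<psi> ` D)"
    using dim_span_eq_card_independent by metis
  also have "\<dots> = card D"
    using DV inj by (meson card_image inj_on_subset)
  finally show ?thesis by (simp add: dim_in_def D_def)
qed

end

section \<open>The first isomorphism theorem for spaces of cosets\<close>

context Vector_Spaces.linear
begin

lemma image_coset:
  assumes "W \<subseteq> {w. f w = 0}" "0 \<in> W"
  shows "f ` (u +o W) = {f u}"
  using assms by (auto simp: elt_set_plus_def add image_iff intro!: bexI[of _ 0])

text \<open>\<open>W\<close> is the kernel of \<open>f\<close> on \<open>U\<close>, so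
  \<open>f\<close> is constant on each coset and separates the cosets in \<open>U\<close>. By
  \<open>image_coset\<close> the image of a coset is a singleton, whose element is the
  coordinate.\<close>

lemma coordinates_quotient:
  assumes U: "vs1.subspace U" and W: "W = U \<inter> {w. f w = 0}"
  shows "coordinates s2 (quotient_space s1 U W) (\<lambda>A. the_elem (f ` A))"
proof -
  have W0: "W \<subseteq> {w. f w = 0}" "0 \<in> W"
    using U by (auto simp: W vs1.subspace_def)
  have sW: "vs1.subspace W"
    unfolding W using U subspace_kernel by (intro vs1.subspace_inter) auto
  have coset: "the_elem (f ` (u +o W)) = f u" for u
    using image_coset[OF W0] by simp
  have WW: "W + W = W"
  proof
    show "W + W \<subseteq> W" using sW by (auto simp: vs1.subspace_add elim!: set_plus_elim)
    show "W \<subseteq> W + W" using W0(2) set_plus_intro[of 0 W _ W] by force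
  qed
  have plus: "(u +o W) + (v +o W) = (u + v) +o W" for u v
    by (simp add: set_plus_rearrange WW)
  have scal: "s1 c ` (u +o W) + W = s1 c u +o W" for c u
  proof
    show "s1 c ` (u +o W) + W \<subseteq> s1 c u +o W"
    proof
      fix x assume "x \<in> s1 c ` (u +o W) + W"
      then obtain w w' where "w \<in> W" "w' \<in> W" "x = s1 c (u + w) + w'"
        by (auto simp: elt_set_plus_def elim!: set_plus_elim)
      moreover from this have "s1 c w + w' \<in> W" using sW by (simp add: vs1.subspace_def)
      ultimately show "x \<in> s1 c u +o W"
        by (auto simp: elt_set_plus_def vs1.scale_right_distrib algebra_simps)
    qed
    show "s1 c u +o W \<subseteq> s1 c ` (u +o W) + W"
    proof
      fix x assume "x \<in> s1 c u +o W"
      then obtain w where "w \<in> W" "x = s1 c u + w" by (auto simp: elt_set_plus_def)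
      moreover have "u \<in> u +o W" using W0(2) by (auto simp: elt_set_plus_def)
      ultimately show "x \<in> s1 c ` (u +o W) + W" by auto
    qed
  qed
  have zero: "W = 0 +o W" by (auto simp: elt_set_plus_def)
  have eq: "u +o W = v +o W" if "f u = f v" "u \<in> U" "v \<in> U" for u v
  proof -
    have uv: "u - v \<in> W" "v - u \<in> W" using that U by (auto simp: W vs1.subspace_diff diff)
    show ?thesis
    proof (intro subset_antisym subsetI)
      fix x assume "x \<in> u +o W"
      then obtain w where "w \<in> W" "x = u + w" by (auto simp: elt_set_plus_def)
      then show "x \<in> v +o W" using vs1.subspace_add[OF sW uv(1)]
        by (auto simp: elt_set_plus_def intro!: bexI[of _ "u - v + w"])
    next
      fix x assume "x \<in> v +o W"
      then obtain w where "w \<in> W" "x = v + w" by (auto simp: elt_set_plus_def)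
      then show "x \<in> u +o W" using vs1.subspace_add[OF sW uv(2)]
        by (auto simp: elt_set_plus_def intro!: bexI[of _ "v - u + w"])
    qed
  qed
  show ?thesis
  proof
    show "inj_on (\<lambda>A. the_elem (f ` A)) (carrier (quotient_space s1 U W))"
      by (rule inj_onI) (clarsimp simp: quotient_space_def coset, rule eq)
    show "subspace_in (quotient_space s1 U W) (carrier (quotient_space s1 U W))"
      using U image_eqI[where f = "\<lambda>u. u +o W", OF zero vs1.subspace_0[OF U]]
      by (auto simp: subspace_in_def quotient_space_def plus scal vs1.subspace_add vs1.subspace_scale)
    show "the_elem (f ` vzero (quotient_space s1 U W)) = 0"
      using coset[of 0] zero by (simp add: quotient_space_def)
    fix A B c
    assume A: "A \<in> carrier (quotient_space s1 U W)"
    then obtain u where u: "A = u +o W" by (auto simp: quotient_space_def)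
    show "the_elem (f ` vscal (quotient_space s1 U W) c A) = s2 c (the_elem (f ` A))"
      by (simp add: quotient_space_def u scal coset scale)
    assume "B \<in> carrier (quotient_space s1 U W)"
    then obtain v where v: "B = v +o W" by (auto simp: quotient_space_def)
    show "the_elem (f ` vadd (quotient_space s1 U W) A B) = the_elem (f ` A) + the_elem (f ` B)"
      by (simp add: quotient_space_def u v plus coset add)
  qed
qed

end

section \<open>Monomial functions over a field\<close>

text \<open>A nonzero polynomial has at most \<open>degree p\<close> roots. The degree bound is
  conditional on finiteness so that one statement serves finite and infinite fields.\<close>

lemma poly_eq_0_if_all_roots:
  fixes p :: "'k::field poly"
  assumes roots: "\<And>x. poly p x = 0"
    and deg: "finite (UNIV :: 'k set) \<Longrightarrow> degree p < card (UNIV :: 'k set)"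
  shows "p = 0"
proof (rule ccontr)
  assume p: "p \<noteq> 0"
  have "{x. poly p x = 0} = UNIV" using roots by auto
  with poly_roots_finite[OF p] have fin: "finite (UNIV :: 'k set)" by simp
  show False
    using card_poly_roots_bound[OF p] roots deg[OF fin] by simp
qed

text \<open>Induction on the number of variables. With all variables but the last fixed, the sum is
  a polynomial in the last one that vanishes everywhere, hence is 0; its coefficients are sums of
  the same kind in the other variables.\<close>

lemma monomial_functions_independent:
  fixes c :: "'x \<Rightarrow> 'k::field" and e :: "'x \<Rightarrow> nat \<Rightarrow> nat"
  assumes "finite S"
    and "\<And>x k. x \<in> S \<Longrightarrow> finite (UNIV :: 'k set) \<Longrightarrow> e x k < card (UNIV :: 'k set)"
    and "\<And>x y. x \<in> S \<Longrightarrow> y \<in> S \<Longrightarrow> (\<forall>k<N. e x k = e y k) \<Longrightarrow> x = y"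
    and "\<And>t. (\<Sum>x\<in>S. c x * (\<Prod>k<N. t k ^ e x k)) = 0"
    and "x \<in> S"
  shows "c x = 0"
  using assms
proof (induction N arbitrary: S)
  case 0
  \<comment> \<open>Without variables all exponent vectors agree, so distinctness leaves a single
    term.\<close>
  then have "S = {x}" by auto
  with 0(4) show ?case by simp
next
  case (Suc N)
  \<comment> \<open>The terms in the same coefficient as \<open>x\<close>. They share the last
    exponent, so they still differ in the others.\<close>
  define S' where "S' = {y \<in> S. e y N = e x N}"
  show ?case
  proof (rule Suc.IH[of S'])
    show "finite S'" "x \<in> S'" using Suc.prems by (auto simp: S'_def)
    show "e y k < card (UNIV :: 'k set)" if "y \<in> S'" "finite (UNIV :: 'k set)" for y k
      using Suc.prems(2) that by (auto simp: S'_def)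
    show "y = z" if "y \<in> S'" "z \<in> S'" "\<forall>k<N. e y k = e z k" for y z
      using Suc.prems(3)[of y z] that by (auto simp: S'_def less_Suc_eq)
    fix t :: "nat \<Rightarrow> 'k"
    define p where "p = (\<Sum>y\<in>S. monom (c y * (\<Prod>k<N. t k ^ e y k)) (e y N))"
    have "p = 0"
    proof (rule poly_eq_0_if_all_roots)
      fix s
      have "poly p s = (\<Sum>y\<in>S. c y * (\<Prod>k<Suc N. (t(N := s)) k ^ e y k))"
        by (simp add: p_def poly_sum poly_monom mult.assoc)
      then show "poly p s = 0" by (simp only: Suc.prems(4))
    next
      assume fin: "finite (UNIV :: 'k set)"
      have "degree p \<le> card (UNIV :: 'k set) - 1"
        unfolding p_def
      proof (rule degree_sum_le[OF Suc.prems(1)])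
        fix y assume "y \<in> S"
        from Suc.prems(2)[OF this fin, of N]
        show "degree (monom (c y * (\<Prod>k<N. t k ^ e y k)) (e y N)) \<le> card (UNIV :: 'k set) - 1"
          by (intro order.trans[OF degree_monom_le]) simp
      qed
      then show "degree p < card (UNIV :: 'k set)"
        using finite_UNIV_card_ge_0[OF fin] by simp
    qed
    then have "0 = coeff p (e x N)" by simp
    also have "\<dots> = (\<Sum>y\<in>S. if e y N = e x N then c y * (\<Prod>k<N. t k ^ e y k) else 0)"
      by (simp add: p_def coeff_sum)
    also have "\<dots> = (\<Sum>y\<in>S'. c y * (\<Prod>k<N. t k ^ e y k))"
      unfolding S'_def using Suc.prems(1) by (rule sum.inter_filter[symmetric])
    finally show "(\<Sum>y\<in>S'. c y * (\<Prod>k<N. t k ^ e y k)) = 0" by simp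
  qed
qed

section \<open>Reduction of exponents over a finite field\<close>

lemma field_power_card_eq_same:
  fixes x :: "'k::field"
  assumes "finite (UNIV :: 'k set)"
  shows "x ^ card (UNIV :: 'k set) = x"
proof (cases "x = 0")
  case True
  then show ?thesis using finite_UNIV_card_ge_0[OF assms] by simp
next
  case x: False
  define U where "U = UNIV - {0 :: 'k}"
  have fin: "finite U" using assms by (simp add: U_def finite_subset[OF subset_UNIV])
  \<comment> \<open>Multiplication by \<open>x\<close> permutes the nonzero elements; cancelling
    their product leaves \<open>x ^ card U = 1\<close>.\<close>
  have "bij_betw ((*) x) U U"
    by (rule bij_betwI[of _ _ _ "\<lambda>y. y / x"]) (use x in \<open>auto simp: U_def\<close>)
  then have "(\<Prod>y\<in>U. y) = (\<Prod>y\<in>U. x * y)"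
    by (rule prod.reindex_bij_betw[symmetric])
  also have "\<dots> = x ^ card U * (\<Prod>y\<in>U. y)" by (simp add: prod.distrib)
  finally have "x ^ card U = 1" using fin by (auto simp: U_def)
  moreover have "card (UNIV :: 'k set) = Suc (card U)"
    using card.remove[OF assms, of 0] by (simp add: U_def)
  ultimately show ?thesis by simp
qed

lemma two_le_card_field: "finite (UNIV :: 'k::field set) \<Longrightarrow> 2 \<le> card (UNIV :: 'k set)"
  using card_mono[of "UNIV :: 'k set" "{0, 1}"] by simp

text \<open>In a field with \<open>q\<close> elements, \<open>q\<close> copies of a letter can be
  replaced by one without changing the function. This shrinks the multiset because \<open>q\<close>
  is at least 2, so the process ends.\<close>

lemma reduced_multiset:
  fixes M :: "nat multiset"
  assumes fin: "finite (UNIV :: 'k::field set)"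
  obtains M' where "\<And>k. count M' k < card (UNIV :: 'k set)"
    and "\<And>t :: nat \<Rightarrow> 'k. prod_mset (image_mset t M') = prod_mset (image_mset t M)"
proof -
  let ?q = "card (UNIV :: 'k set)"
  have q: "2 \<le> ?q" using fin by (rule two_le_card_field)
  have "\<exists>M'. (\<forall>k. count M' k < ?q) \<and>
      (\<forall>t :: nat \<Rightarrow> 'k. prod_mset (image_mset t M') = prod_mset (image_mset t M))"
  proof (induction "size M" arbitrary: M rule: less_induct)
    case less
    show ?case
    proof (cases "\<forall>k. count M k < ?q")
      case True
      then show ?thesis by blast
    next
      case False
      then obtain k where k: "?q \<le> count M k" by (auto simp: not_less)
      define R where "R = M - replicate_mset ?q k"
      have M: "M = replicate_mset ?q k + R"
        using k by (simp add: R_def count_le_replicate_mset_subset_eq)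
      have "size (add_mset k R) < size M" using q arg_cong[OF M, of size] by simp
      from less[OF this] obtain M' where "\<forall>k. count M' k < ?q"
        and M': "\<And>t :: nat \<Rightarrow> 'k. prod_mset (image_mset t M') = prod_mset (image_mset t (add_mset k R))"
        by blast
      moreover have "prod_mset (image_mset t (add_mset k R)) = prod_mset (image_mset t M)"
        for t :: "nat \<Rightarrow> 'k"
        by (subst M) (simp add: field_power_card_eq_same[OF fin])
      ultimately show ?thesis by (intro exI[of _ M']) simp
    qed
  qed
  with that show thesis by blast
qed

lemma prod_mset_image_eq_prod:
  fixes M :: "nat multiset"
  assumes "set_mset M \<subseteq> {..<N}"
  shows "prod_mset (image_mset t M) = (\<Prod>k<N. t k ^ count M k)"
  using assms
proof (induction M)
  case (add x M)
  have "(\<Prod>k<N. t k ^ count (add_mset x M) k)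
      = (\<Prod>k<N. (if k = x then t k else 1) * t k ^ count M k)"
    by (intro prod.cong) auto
  with add show ?case by (simp add: prod.distrib prod.delta)
qed simp

section \<open>The coefficient functions of a polynomial\<close>

definition fun_scal :: "'k::field \<Rightarrow> ('x \<Rightarrow> 'k) \<Rightarrow> 'x \<Rightarrow> 'k" where
  "fun_scal c g = (\<lambda>x. c * g x)"

interpretation fun_space: vector_space fun_scal
  by unfold_locales (auto simp: fun_scal_def fun_eq_iff algebra_simps)

interpretation free: leibniz_algebra free_leibniz_algebra
  by (rule leibniz_algebra_free_leibniz)

interpretation fl: vector_space fl_scal
  using free.vector_space_axioms by (simp add: free_leibniz_algebra_def)

text \<open>This algebra is not in the theorem: it is the simplest one with the same identities.\<close>

definition model :: "('k::field, 'k \<times> 'k) algebra" where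
  "model = \<lparr>scal = (\<lambda>c a. (c * fst a, c * snd a)), prd = (\<lambda>a b. (fst a * snd b, 0))\<rparr>"

lemma prd_model [simp]: "prd model a b = (fst a * snd b, 0)"
  and scal_model [simp]: "scal model c a = (c * fst a, c * snd a)"
  by (simp_all add: model_def)

interpretation model: leibniz_algebra model
  by unfold_locales (auto simp: prod_eq_iff algebra_simps)

text \<open>In \<open>model\<close> the first coordinate of a product involves the first coordinate
  of its leftmost letter only. The indicator of \<open>fst z\<close> thus isolates the monomials
  that begin with this letter.\<close>

definition point :: "nat \<times> (nat \<Rightarrow> 'k::field) \<Rightarrow> nat \<Rightarrow> 'k \<times> 'k" where
  "point z k = (if k = fst z then 1 else 0, snd z k)"

text \<open>\<open>coeff_fun f (i, t)\<close> is the coefficient of the first coordinate of \<open>x\<^sub>i\<close> when f is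
  evaluated in the model with second coordinates t; it is a polynomial function of t.\<close>

definition coeff_fun :: "'k::field free_leibniz \<Rightarrow> nat \<times> (nat \<Rightarrow> 'k) \<Rightarrow> 'k" where
  "coeff_fun f z = fst (eval_at model (point z) f)"

interpretation coeff_fun: Vector_Spaces.linear fl_scal fun_scal coeff_fun
  by unfold_locales
    (auto simp: coeff_fun_def fun_eq_iff fun_scal_def model.eval_at_add model.eval_at_scal)

text \<open>A pair \<open>(i, M)\<close> represents all left-normed monomials with leading letter
  \<open>i\<close> followed by the letters of \<open>M\<close> in some order; the leading occurrence
  of \<open>i\<close> is not counted in \<open>M\<close>.\<close>

definition monomial_fun :: "nat \<times> nat multiset \<Rightarrow> nat \<times> (nat \<Rightarrow> 'k::field) \<Rightarrow> 'k" where
  "monomial_fun = (\<lambda>(i, M) (i', t). if i' = i then prod_mset (image_mset t M) else 0)"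

text \<open>A single letter is a separate case: it keeps its second coordinate, whereas every
  product has second coordinate 0.\<close>

lemma eval_at_left_normed:
  "eval_at model (point (i', t)) (left_normed (map var (i # ks)))
    = (if ks = [] then point (i', t) i else (monomial_fun (i, mset ks) (i', t), 0))"
proof (induction ks rule: rev_induct)
  case Nil
  then show ?case by (simp add: model.eval_at_var)
next
  case (snoc k ks)
  then show ?case
    by (auto simp: model.eval_at_prd model.eval_at_var monomial_fun_def point_def)
qed

lemma coeff_fun_left_normed:
  "coeff_fun (left_normed (map var (i # ks))) = (monomial_fun (i, mset ks) :: _ \<Rightarrow> 'k::field)"
proof
  fix z :: "nat \<times> (nat \<Rightarrow> 'k)"
  obtain i' t where "z = (i', t)" by fastforce
  then show "coeff_fun (left_normed (map var (i # ks))) z = monomial_fun (i, mset ks) z"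
    by (simp add: coeff_fun_def eval_at_left_normed point_def monomial_fun_def
        del: left_normed.simps list.map)
qed

lemma eval_at_monomial:
  "leibniz_algebra L \<Longrightarrow> eval_at L \<rho> (monomial w) = word_eval L \<rho> w"
  by (induction w) (simp_all add: leibniz_algebra.eval_at_var leibniz_algebra.eval_at_prd)

text \<open>A right factor acts through its second coordinate, which is 0 for any product. Hence
  only words that grow by single letters on the right can have a nonzero coefficient
  function.\<close>

lemma coeff_fun_Node:
  "coeff_fun (monomial (Node u v)) (i, t)
    = coeff_fun (monomial u) (i, t) * (case v of Letter k \<Rightarrow> t k | Node _ _ \<Rightarrow> 0)"
  by (simp only: coeff_fun_def eval_at_monomial[OF model.leibniz_algebra_axioms])
    (auto simp: point_def split: magma.split)

lemma coeff_fun_monomial: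
  "coeff_fun (monomial w) = (0 :: _ \<Rightarrow> 'k::field) \<or>
    (\<exists>i ks. leaves w = i # ks \<and>
      coeff_fun (monomial w) = (monomial_fun (i, mset ks) :: _ \<Rightarrow> 'k))"
proof (induction w)
  case (Letter i)
  have "coeff_fun (monomial (Letter i)) = (monomial_fun (i, mset []) :: _ \<Rightarrow> 'k)"
    by (simp add: coeff_fun_left_normed[of i "[]", simplified])
  then show ?case by simp
next
  case (Node u v)
  show ?case
  proof (cases v)
    case v: (Letter k)
    from Node.IH(1) show ?thesis
    proof (elim disjE exE conjE)
      fix i ks assume u: "leaves u = i # ks"
        "coeff_fun (monomial u) = (monomial_fun (i, mset ks) :: _ \<Rightarrow> 'k)"
      have "coeff_fun (monomial (Node u v)) = (monomial_fun (i, mset (ks @ [k])) :: _ \<Rightarrow> 'k)"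
        by (rule ext, clarify, simp only: coeff_fun_Node u v) (auto simp: monomial_fun_def)
      then show ?thesis using u v by auto
    qed (auto simp: fun_eq_iff coeff_fun_Node simp del: monomial.simps)
  qed (auto simp: fun_eq_iff coeff_fun_Node simp del: monomial.simps)
qed

section \<open>Spans and independence of monomials and their functions\<close>

lemma abs_free_leibniz_eq_sum:
  fixes p :: "'k::field na_poly"
  shows "abs_free_leibniz p
    = (\<Sum>w\<in>Poly_Mapping.keys p. fl_scal (Poly_Mapping.lookup p w) (monomial w))"
proof -
  have single: "abs_free_leibniz (Poly_Mapping.single w c) = fl_scal c (monomial w)"
    for w and c :: 'k
  proof -
    have "abs_free_leibniz (Poly_Mapping.single w 1) = (monomial w :: 'k free_leibniz)"
    proof (induction w)
      case (Node u v)
      have "na_prd (Poly_Mapping.single u 1) (Poly_Mapping.single v 1)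
          = (Poly_Mapping.single (Node u v) 1 :: 'k na_poly)"
        by (rule poly_mapping_eqI, rename_tac w, case_tac w)
          (auto simp: lookup_single when_def)
      with Node show ?case by (simp flip: Node times_free_leibniz.abs_eq add: times_free_leibniz.abs_eq)
    qed (simp add: var.abs_eq)
    moreover have "na_scal c (Poly_Mapping.single w 1) = Poly_Mapping.single w c"
      by (rule poly_mapping_eqI) (auto simp: lookup_single when_def)
    ultimately show ?thesis by (metis fl_scal.abs_eq)
  qed
  have sum: "abs_free_leibniz (sum g S) = (\<Sum>s\<in>S. abs_free_leibniz (g s))"
    for g :: "magma \<Rightarrow> 'k na_poly" and S
    by (induction S rule: infinite_finite_induct)
      (simp_all add: zero_free_leibniz_def plus_free_leibniz.abs_eq[symmetric])
  have "p = (\<Sum>w\<in>Poly_Mapping.keys p. Poly_Mapping.single w (Poly_Mapping.lookup p w))"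
    by (rule poly_mapping_eqI)
      (auto simp: lookup_sum lookup_single when_def in_keys_iff)
  then show ?thesis by (metis (no_types, lifting) single sum sum.cong)
qed

lemma span_monomials: "fl.span (range monomial) = (UNIV :: 'k::field free_leibniz set)"
proof -
  have "f \<in> fl.span (range monomial)" for f :: "'k free_leibniz"
    by (induction f rule: free_leibniz.abs_induct)
      (unfold abs_free_leibniz_eq_sum, intro fl.span_sum fl.span_scale fl.span_base rangeI)
  then show ?thesis by auto
qed

text \<open>Evaluation at \<open>(i, t)\<close> kills every function with another leading letter and
  leaves a relation between ordinary monomial functions of \<open>t\<close>, to which
  \<open>monomial_functions_independent\<close> applies.\<close>

lemma monomial_fun_independent:
  fixes X :: "(nat \<times> nat multiset) set"
  assumes X: "\<And>i M k. (i, M) \<in> X \<Longrightarrow> finite (UNIV :: 'k::field set) \<Longrightarrow> count M k < card (UNIV :: 'k set)"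
  shows "inj_on (monomial_fun :: _ \<Rightarrow> _ \<Rightarrow> 'k) X"
    and "fun_space.independent ((monomial_fun :: _ \<Rightarrow> _ \<Rightarrow> 'k) ` X)"
proof -
  have zero: "c x = 0"
    if S: "finite S" "S \<subseteq> X" "(\<Sum>x\<in>S. fun_scal (c x) (monomial_fun x)) = 0" "x \<in> S"
    for S and c :: "_ \<Rightarrow> 'k" and x
  proof -
    obtain i M where x: "x = (i, M)" by fastforce
    define T where "T = {M. (i, M) \<in> S}"
    have S_T: "{y \<in> S. fst y = i} = Pair i ` T" by (auto simp: T_def)
    have finT: "finite T"
      by (rule finite_imageD[of "Pair i"]) (use S(1) in \<open>auto simp flip: S_T simp: inj_on_def\<close>)
    have "finite (\<Union> (set_mset ` T))" using finT by auto
    \<comment> \<open>Finitely many multisets involve finitely many letters, so the counts below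
      \<open>N\<close> determine them.\<close>
    then obtain N where N: "\<Union> (set_mset ` T) \<subseteq> {..<N}"
      using finite_nat_bounded by blast
    have "c (i, M) = 0"
    proof (rule monomial_functions_independent[where S = T and e = count and N = N and c = "\<lambda>M. c (i, M)"])
      show "finite T" "M \<in> T" using finT S(4) by (auto simp: T_def x)
      show "count M k < card (UNIV :: 'k set)" if "M \<in> T" "finite (UNIV :: 'k set)" for M k
        using that X S(2) by (auto simp: T_def)
      show "A = B" if AB: "A \<in> T" "B \<in> T" "\<forall>k<N. count A k = count B k" for A B
      proof (rule multiset_eqI)
        fix k show "count A k = count B k"
        proof (cases "k < N")
          case False
          then have "k \<notin># A" "k \<notin># B" using N AB by auto
          then show ?thesis by (simp add: not_in_iff)
        qed (use AB in auto)
      qed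
      fix t :: "nat \<Rightarrow> 'k"
      have "0 = (\<Sum>y\<in>S. fun_scal (c y) (monomial_fun y)) (i, t)" using S(3) by simp
      also have "\<dots> = (\<Sum>y\<in>S. c y * monomial_fun y (i, t))"
        using S(1) by (induction S rule: finite_induct) (simp_all add: fun_scal_def)
      also have "\<dots> = (\<Sum>y\<in>S. if fst y = i then c y * prod_mset (image_mset t (snd y)) else 0)"
        by (intro sum.cong) (auto simp: monomial_fun_def)
      also have "\<dots> = (\<Sum>y\<in>{y \<in> S. fst y = i}. c y * prod_mset (image_mset t (snd y)))"
        using S(1) by (rule sum.inter_filter[symmetric])
      also have "\<dots> = (\<Sum>M\<in>T. c (i, M) * prod_mset (image_mset t M))"
        by (simp add: S_T sum.reindex inj_on_def)
      also have "\<dots> = (\<Sum>M\<in>T. c (i, M) * (\<Prod>k<N. t k ^ count M k))"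
        using N by (intro sum.cong refl) (subst prod_mset_image_eq_prod, auto)
      finally show "(\<Sum>M\<in>T. c (i, M) * (\<Prod>k<N. t k ^ count M k)) = 0" by simp
    qed
    then show ?thesis by (simp add: x)
  qed
  show inj: "inj_on (monomial_fun :: _ \<Rightarrow> _ \<Rightarrow> 'k) X"
  proof (rule inj_onI, rule ccontr)
    fix x y assume xy: "x \<in> X" "y \<in> X" "x \<noteq> y"
      "(monomial_fun x :: _ \<Rightarrow> 'k) = monomial_fun y"
    \<comment> \<open>Two indices with equal functions would satisfy a relation with coefficients 1
      and -1.\<close>
    then have "(\<Sum>z\<in>{x, y}. fun_scal (if z = x then 1 else - 1) (monomial_fun z :: _ \<Rightarrow> 'k)) = 0"
      by (auto simp: fun_scal_def fun_eq_iff)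
    from zero[OF _ _ this, of x] xy show False by simp
  qed
  show "fun_space.independent ((monomial_fun :: _ \<Rightarrow> _ \<Rightarrow> 'k) ` X)"
    unfolding fun_space.independent_explicit_module
  proof (intro allI impI)
    fix S u and v :: "nat \<times> (nat \<Rightarrow> 'k) \<Rightarrow> 'k"
    assume S: "finite S" "S \<subseteq> monomial_fun ` X" "(\<Sum>v\<in>S. fun_scal (u v) v) = 0" "v \<in> S"
    then obtain Y where Y: "Y \<subseteq> X" "S = monomial_fun ` Y" by (auto simp: subset_image_iff)
    have injY: "inj_on (monomial_fun :: _ \<Rightarrow> _ \<Rightarrow> 'k) Y" using inj Y(1) by (rule inj_on_subset)
    from S(4) Y obtain y where y: "y \<in> Y" "v = monomial_fun y" by auto
    have "(u \<circ> monomial_fun) y = 0"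
    proof (rule zero[OF _ Y(1) _ y(1)])
      show "finite Y" using S(1) injY by (auto simp: Y(2) dest: finite_imageD)
      show "(\<Sum>x\<in>Y. fun_scal ((u \<circ> monomial_fun) x) (monomial_fun x)) = 0"
        using S(3) by (simp add: Y(2) sum.reindex[OF injY] o_def)
    qed
    then show "u v = 0" by (simp add: y)
  qed
qed

lemma range_coeff_fun:
  "range coeff_fun = fun_space.span (range (monomial_fun :: _ \<Rightarrow> _ \<Rightarrow> 'k::field))"
proof -
  have range: "range coeff_fun = fun_space.span (coeff_fun ` range (monomial :: _ \<Rightarrow> 'k free_leibniz))"
    by (simp only: coeff_fun.span_image span_monomials)
  also have "\<dots> = fun_space.span (range monomial_fun)"
  proof (rule fun_space.span_eq[THEN iffD2], intro conjI subsetI)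
    fix g :: "nat \<times> (nat \<Rightarrow> 'k) \<Rightarrow> 'k"
    assume "g \<in> coeff_fun ` range monomial"
    then obtain w where "g = coeff_fun (monomial w)" by blast
    then show "g \<in> fun_space.span (range monomial_fun)"
      using coeff_fun_monomial[where w = w and 'k = 'k]
      by (auto intro: fun_space.span_base fun_space.span_zero)
  next
    fix g :: "nat \<times> (nat \<Rightarrow> 'k) \<Rightarrow> 'k"
    assume "g \<in> range monomial_fun"
    then obtain i M where g: "g = monomial_fun (i, M)" by auto
    obtain ks where "mset ks = M" using ex_mset by blast
    then have "g \<in> range coeff_fun" using coeff_fun_left_normed[of i ks] g by (metis rangeI)
    then show "g \<in> fun_space.span (coeff_fun ` range monomial)"
      by (simp only: range)
  qed
  finally show ?thesis .
qed

section \<open>Algebras with product \<open>xy = l(y) P(x)\<close>\<close>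

text \<open>Adding a multiple of \<open>v\<close> adjusts \<open>l\<close> without changing
  \<open>P\<close>, and \<open>u\<close> marks one letter by a nonzero value of \<open>P\<close>.
  Together they give enough substitutions to recover \<open>coeff_fun\<close>.\<close>

locale projection_algebra = leibniz_algebra L for L :: "('k::field, 'a::ab_group_add) algebra" +
  fixes P :: "'a \<Rightarrow> 'a" and l :: "'a \<Rightarrow> 'k" and u v :: 'a
  assumes P_add: "P (x + y) = P x + P y"
    and P_scal: "P (scal L c x) = scal L c (P x)"
    and l_add: "l (x + y) = l x + l y"
    and l_scal: "l (scal L c x) = c * l x"
    and prd_eq: "prd L x y = scal L (l y) (P x)"
    and P_idem: "P (P x) = P x"
    and l_P: "l (P x) = 0"
    and u: "P u = u" "u \<noteq> 0"
    and v: "P v = 0" "l v = 1"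
begin

interpretation P: Vector_Spaces.linear "scal L" "scal L" P
  by unfold_locales (simp_all add: P_add P_scal)

text \<open>The second summand carries the component of a letter in the kernel of \<open>P\<close>.
  Its coefficient, taken at \<open>t = 0\<close>, is 1 for a single letter and 0 for every longer
  word.\<close>

lemma word_eval_eq:
  "word_eval L \<rho> w =
    scal L (coeff_fun (monomial w) (hd (leaves w), \<lambda>k. l (\<rho> k))) (P (\<rho> (hd (leaves w)))) +
    scal L (coeff_fun (monomial w) (hd (leaves w), 0)) (\<rho> (hd (leaves w)) - P (\<rho> (hd (leaves w))))"
proof (induction w)
  case (Letter i)
  have "coeff_fun (monomial (Letter i)) = (monomial_fun (i, {#}) :: _ \<Rightarrow> 'k)"
    by (simp add: coeff_fun_left_normed[of i "[]", simplified])
  then show ?case by (simp add: monomial_fun_def)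
next
  case (Node u v)
  have "leaves u \<noteq> []" by (induction u) auto
  then have hd: "hd (leaves (Node u v)) = hd (leaves u)" by simp
  \<comment> \<open>\<open>P\<close> is idempotent and so kills the second summand; below,
    \<open>l\<close> vanishes on products because it vanishes on the image of
    \<open>P\<close>.\<close>
  have P: "P (word_eval L \<rho> u)
      = scal L (coeff_fun (monomial u) (hd (leaves u), \<lambda>k. l (\<rho> k))) (P (\<rho> (hd (leaves u))))"
    by (subst Node.IH(1)) (simp add: P_add P_scal P.diff P_idem)
  have l: "l (word_eval L \<rho> v) = (case v of Letter k \<Rightarrow> l (\<rho> k) | Node _ _ \<Rightarrow> 0)"
    by (cases v) (simp_all add: prd_eq l_scal l_P)
  show ?case
    unfolding hd coeff_fun_Node
    by (simp add: prd_eq P l mult.commute split: magma.split)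
qed

text \<open>Words are grouped by leading letter. The set \<open>I\<close> does not depend on \<rho>,
  and \<open>J\<close> lets a caller include a letter that may lead no word of
  \<open>f\<close>.\<close>

lemma eval_at_eq:
  assumes "finite J"
  obtains I where "finite I" "J \<subseteq> I"
    "\<And>\<rho>. eval_at L \<rho> f =
      (\<Sum>i\<in>I. scal L (coeff_fun f (i, \<lambda>k. l (\<rho> k))) (P (\<rho> i)) +
        scal L (coeff_fun f (i, 0)) (\<rho> i - P (\<rho> i)))"
proof -
  obtain p where f: "f = abs_free_leibniz p" using free_leibniz.abs_induct[of "\<lambda>f. \<exists>p. f = abs_free_leibniz p" f] by blast
  define h where "h w = hd (leaves w)" for w
  define I where "I = J \<union> h ` Poly_Mapping.keys p"
  let ?c = "Poly_Mapping.lookup p"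
  have finI: "finite I" using assms by (simp add: I_def)
  have cf: "coeff_fun f z = (\<Sum>w\<in>Poly_Mapping.keys p. ?c w * coeff_fun (monomial w) z)" for z
  proof -
    have "coeff_fun f
        = (\<Sum>w\<in>Poly_Mapping.keys p. fun_scal (?c w) (coeff_fun (monomial w)))"
      by (simp add: f abs_free_leibniz_eq_sum coeff_fun.sum coeff_fun.scale)
    moreover have "(\<Sum>w\<in>K. fun_scal (?c w) (coeff_fun (monomial w))) z
        = (\<Sum>w\<in>K. ?c w * coeff_fun (monomial w) z)" for K
      by (induction K rule: infinite_finite_induct) (simp_all add: fun_scal_def)
    ultimately show ?thesis by simp
  qed
  have off: "coeff_fun (monomial w) (i, t) = 0" if "i \<noteq> h w" for w i and t :: "nat \<Rightarrow> 'k"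
    using that coeff_fun_monomial[where w = w and 'k = 'k]
    by (auto simp: h_def monomial_fun_def)
  have "eval_at L \<rho> f =
      (\<Sum>i\<in>I. scal L (coeff_fun f (i, \<lambda>k. l (\<rho> k))) (P (\<rho> i)) +
        scal L (coeff_fun f (i, 0)) (\<rho> i - P (\<rho> i)))" for \<rho>
  proof -
    let ?g = "\<lambda>w i. scal L (coeff_fun (monomial w) (i, \<lambda>k. l (\<rho> k))) (P (\<rho> i)) +
        scal L (coeff_fun (monomial w) (i, 0)) (\<rho> i - P (\<rho> i))"
    have "eval_at L \<rho> f = (\<Sum>w\<in>Poly_Mapping.keys p. scal L (?c w) (word_eval L \<rho> w))"
      by (simp add: f eval_at_abs na_eval_def)
    \<comment> \<open>Each value is spread over all of \<open>I\<close>, with zeros away from its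
      leading letter, so that the two summations can be exchanged.\<close>
    also have "\<dots> = (\<Sum>w\<in>Poly_Mapping.keys p. scal L (?c w) (\<Sum>i\<in>I. ?g w i))"
    proof (intro sum.cong refl)
      fix w assume "w \<in> Poly_Mapping.keys p"
      then have "h w \<in> I" by (simp add: I_def)
      moreover have "?g w i = 0" if "i \<noteq> h w" for i
        using off[OF that, of "\<lambda>k. l (\<rho> k)"] off[OF that, of 0] by simp
      ultimately have "(\<Sum>i\<in>I. ?g w i) = ?g w (h w)"
        using finI by (subst sum.remove[of I "h w"]) (auto intro!: sum.neutral)
      then show "scal L (?c w) (word_eval L \<rho> w) = scal L (?c w) (\<Sum>i\<in>I. ?g w i)"
        by (simp only: word_eval_eq[of \<rho> w] h_def)
    qed
    also have "\<dots> = (\<Sum>i\<in>I. \<Sum>w\<in>Poly_Mapping.keys p. scal L (?c w) (?g w i))"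
      by (simp only: scale_sum_right) (rule sum.swap)
    also have "\<dots> = (\<Sum>i\<in>I. scal L (coeff_fun f (i, \<lambda>k. l (\<rho> k))) (P (\<rho> i)) +
        scal L (coeff_fun f (i, 0)) (\<rho> i - P (\<rho> i)))"
      by (simp only: cf scale_right_distrib scale_scale scale_sum_left sum.distrib)
    finally show ?thesis .
  qed
  moreover have "J \<subseteq> I" by (simp add: I_def)
  ultimately show thesis using that finI by blast
qed

lemma T_ideal_eq: "T_ideal L = {f. coeff_fun f = 0}"
proof (intro subset_antisym subsetI CollectI)
  fix f assume f: "f \<in> T_ideal L"
  show "coeff_fun f = 0"
  proof
    fix z :: "nat \<times> (nat \<Rightarrow> 'k)"
    obtain i t where z: "z = (i, t)" by fastforce
    \<comment> \<open>This gives \<open>l (\<rho> k) = t k\<close> for all \<open>k\<close>, while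
      \<open>P (\<rho> k)\<close> is nonzero for \<open>k = i\<close> only.\<close>
    define \<rho> where "\<rho> k = scal L (t k) v + (if k = i then u else 0)" for k
    have "l 0 = 0" "l u = 0" using l_P[of 0] l_P[of u] by (simp_all add: u)
    then have l: "l (\<rho> k) = t k" for k by (simp add: \<rho>_def l_add l_scal v)
    have P: "P (\<rho> k) = (if k = i then u else 0)" for k by (simp add: \<rho>_def P_add P_scal u v)
    obtain I where I: "finite I" "{i} \<subseteq> I" "\<And>\<rho>. eval_at L \<rho> f =
      (\<Sum>k\<in>I. scal L (coeff_fun f (k, \<lambda>k. l (\<rho> k))) (P (\<rho> k)) +
        scal L (coeff_fun f (k, 0)) (\<rho> k - P (\<rho> k)))"
      by (rule eval_at_eq[where J = "{i}" and f = f, OF finite.insertI[OF finite.emptyI]])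
        (rule that)
    \<comment> \<open>Applying \<open>P\<close> removes the degree-one terms
      \<open>\<rho> k - P (\<rho> k)\<close> and leaves a multiple of \<open>u\<close>.\<close>
    have "0 = P (eval_at L \<rho> f)" using f by (simp add: T_ideal_def)
    also have "\<dots> = (\<Sum>k\<in>I. scal L (coeff_fun f (k, t)) (P (\<rho> k)))"
      by (simp add: I(3) P.sum P_add P_scal P.diff P_idem l)
    also have "\<dots> = (\<Sum>k\<in>I. if k = i then scal L (coeff_fun f (i, t)) u else 0)"
      by (intro sum.cong) (auto simp: P)
    also have "\<dots> = scal L (coeff_fun f (i, t)) u" using I(1,2) by simp
    finally show "coeff_fun f z = 0 z" using u(2) by (simp add: z)
  qed
next
  fix f :: "'k free_leibniz" assume f: "f \<in> {f. coeff_fun f = 0}"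
  show "f \<in> T_ideal L"
    unfolding T_ideal_def
  proof (intro CollectI allI)
    fix \<rho>
    obtain I where "\<And>\<rho>. eval_at L \<rho> f =
      (\<Sum>k\<in>I. scal L (coeff_fun f (k, \<lambda>k. l (\<rho> k))) (P (\<rho> k)) +
        scal L (coeff_fun f (k, 0)) (\<rho> k - P (\<rho> k)))"
      by (rule eval_at_eq[where J = "{}" and f = f, OF finite.emptyI])
        (rule that)
    then show "eval_at L \<rho> f = 0" using f by simp
  qed
qed

end

text \<open>In each of the four algebras only one basis element acts nontrivially from the right;
  \<open>l\<close> is its coordinate and \<open>P\<close> is right multiplication by it.\<close>

lemma projection_algebra_L11:
  "projection_algebra L11 (\<lambda>x. x $ 1 *s bv 1 + x $ 2 *s bv 2) (\<lambda>x. x $ 3) (bv 1) (bv 3)"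
  unfolding projection_algebra_def projection_algebra_axioms_def
  by (simp add: leibniz_algebra_L11)
    (simp add: L11_def table_algebra_def vec_eq_iff forall_3 sum_3 axis_def algebra_simps)

text \<open>The acting element has square \<open>bv 1\<close>, so \<open>P\<close> does not kill it;
  subtracting \<open>bv 1\<close> puts it into the kernel and keeps \<open>l\<close> equal to 1. The
  same correction occurs in \<open>N4\<close>.\<close>

lemma projection_algebra_LL4:
  "projection_algebra LL4 (\<lambda>x. (x $ 1 + x $ 2) *s bv 1) (\<lambda>x. x $ 2) (bv 1) (bv 2 - bv 1)"
  unfolding projection_algebra_def projection_algebra_axioms_def
  by (simp add: leibniz_algebra_LL4)
    (simp add: LL4_def table_algebra_def vec_eq_iff forall_2 sum_2 axis_def algebra_simps)

lemma projection_algebra_N4: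
  "projection_algebra N4 (\<lambda>x. (x $ 1 + x $ 3) *s bv 1) (\<lambda>x. x $ 3) (bv 1) (bv 3 - bv 1)"
  unfolding projection_algebra_def projection_algebra_axioms_def
  by (simp add: leibniz_algebra_N4)
    (simp add: N4_def table_algebra_def vec_eq_iff forall_3 sum_3 axis_def algebra_simps)

lemma projection_algebra_L10_0:
  "projection_algebra L10_0 (\<lambda>x. (x $ 1 + x $ 2) *s bv 2) (\<lambda>x. x $ 3) (bv 2) (bv 3)"
  unfolding projection_algebra_def projection_algebra_axioms_def
  by (simp add: leibniz_algebra_L10_0)
    (simp add: L10_0_def table_algebra_def vec_eq_iff forall_3 sum_3 axis_def algebra_simps)

section \<open>The monomials and the codimensions\<close>

text \<open>All orders of \<open>M\<close> give the same function. This one is the order in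
  \<open>B4\<close>, where the leading letter is confined to the first block and the other letters
  increase.\<close>

definition sorted_word :: "nat \<times> nat multiset \<Rightarrow> nat list" where
  "sorted_word = (\<lambda>(i, M). i # replicate (count M i) i @ sorted_list_of_multiset {#k \<in># M. k \<noteq> i#})"

definition sorted_monomial :: "nat \<times> nat multiset \<Rightarrow> 'k::field free_leibniz" where
  "sorted_monomial z = left_normed (map var (sorted_word z))"

lemma coeff_fun_sorted_monomial:
  "coeff_fun (sorted_monomial z) = (monomial_fun z :: _ \<Rightarrow> 'k::field)"
proof -
  obtain i M where z: "z = (i, M)" by fastforce
  have "mset (replicate (count M i) i @ sorted_list_of_multiset {#k \<in># M. k \<noteq> i#}) = M"
    by (rule multiset_eqI) simp
  then show ?thesis
    by (simp only: z sorted_monomial_def sorted_word_def prod.case coeff_fun_left_normed)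
qed

definition tail_word :: "nat \<Rightarrow> (nat \<Rightarrow> nat) \<Rightarrow> (nat \<Rightarrow> nat) \<Rightarrow> nat list" where
  "tail_word n j m = concat (map (\<lambda>i. replicate (m i) (j i)) [2..<Suc n])"

definition exponents :: "nat \<Rightarrow> (nat \<Rightarrow> nat) \<Rightarrow> (nat \<Rightarrow> nat) \<Rightarrow> nat multiset" where
  "exponents n j m = replicate_mset (m 1 - 1) (j 1) + mset (tail_word n j m)"

lemma count_tail_word:
  assumes "strict_mono_on {2..n} j"
  shows "i \<in> {2..n} \<Longrightarrow> count (mset (tail_word n j m)) (j i) = m i"
    and "k \<notin> j ` {2..n} \<Longrightarrow> count (mset (tail_word n j m)) k = 0"
proof -
  have "count (mset (concat (map (\<lambda>i. replicate (m i) (j i)) is))) k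
      = (\<Sum>i\<leftarrow>is. if j i = k then m i else 0)" for k "is"
    by (induction "is") auto
  then have *: "count (mset (tail_word n j m)) k = (\<Sum>i\<in>{2..n}. if j i = k then m i else 0)" for k
    by (simp add: tail_word_def sum_list_distinct_conv_sum_set atLeastLessThanSuc_atLeastAtMost
        del: upt_Suc)
  show "count (mset (tail_word n j m)) (j i) = m i" if i: "i \<in> {2..n}"
  proof -
    have "(\<Sum>i'\<in>{2..n}. if j i' = j i then m i' else 0) = (\<Sum>i'\<in>{2..n}. if i' = i then m i' else 0)"
      using inj_onD[OF strict_mono_on_imp_inj_on[OF assms]] i by (intro sum.cong refl) auto
    then show ?thesis using i by (simp add: *)
  qed
  show "count (mset (tail_word n j m)) k = 0" if "k \<notin> j ` {2..n}"
    unfolding * using that by (intro sum.neutral) auto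
qed

lemma sorted_tail_word:
  assumes "strict_mono_on {2..n} j"
  shows "sorted (tail_word n j m)"
proof -
  have "sorted (concat (map (\<lambda>i. replicate (m i) (j i)) is))" if "sorted (map j is)" for "is"
    using that by (induction "is") (auto simp: sorted_append)
  moreover have "sorted (map j [2..<Suc n])"
    using strict_mono_on_imp_mono_on[OF assms]
    by (intro sorted_map_mono) (auto simp: atLeastLessThanSuc_atLeastAtMost simp del: upt_Suc)
  ultimately show ?thesis unfolding tail_word_def by blast
qed

lemma power_monomial_eq:
  assumes "B4_index n j m"
  shows "power_monomial n j m = sorted_monomial (j 1, exponents n j m)"
proof -
  have idx: "1 \<le> n" "1 \<le> m 1" "strict_mono_on {2..n} j" "j 1 \<notin> j ` {2..n}"
    using assms by (auto simp: B4_index_def)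
  have "j 1 \<notin># mset (tail_word n j m)"
    using count_tail_word(2)[OF idx(3,4)] by (simp add: not_in_iff)
  then have tail: "{#k \<in># mset (tail_word n j m). k \<noteq> j 1#} = mset (tail_word n j m)"
    "count (mset (tail_word n j m)) (j 1) = 0"
    by (auto simp: filter_mset_eq_conv not_in_iff)
  have repl: "{#k \<in># replicate_mset a x. k \<noteq> x#} = {#}" for a and x :: nat
    by (induction a) auto
  have "[1..<Suc n] = 1 # [2..<Suc n]"
    using idx(1) by (simp add: upt_conv_Cons del: upt_Suc) (simp add: numeral_2_eq_2)
  moreover have "replicate (m 1) (j 1) = j 1 # replicate (m 1 - 1) (j 1)"
    using idx(2) by (cases "m 1") auto
  ultimately have "concat (map (\<lambda>i. replicate (m i) (j i)) [1..<Suc n])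
      = sorted_word (j 1, exponents n j m)"
    using sorted_tail_word[OF idx(3)] tail
    by (simp add: sorted_word_def exponents_def sorted_sort_id repl flip: tail_word_def del: upt_Suc)
  then have "map var (concat (map (\<lambda>i. replicate (m i) (j i)) [1..<Suc n]))
      = (map var (sorted_word (j 1, exponents n j m)) :: 'a free_leibniz list)"
    by (rule arg_cong)
  then show ?thesis
    by (simp add: power_monomial_def sorted_monomial_def map_concat o_def map_replicate_const del: upt_Suc)
qed

text \<open>One of the \<open>m 1\<close> copies of \<open>j 1\<close> is the leading letter, so the
  exponent is \<open>m 1 - 1\<close> and the strict bound becomes \<open>m 1 \<le> q\<close>.
  Letters that do not occur meet the bound because \<open>q\<close> is positive.\<close>

lemma exponents_less_iff:
  assumes "B4_index n j m" "0 < q"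
  shows "(\<forall>k. count (exponents n j m) k < q) \<longleftrightarrow> m 1 \<le> q \<and> (\<forall>i\<in>{2..n}. m i < q)"
proof -
  have idx: "1 \<le> m 1" "strict_mono_on {2..n} j" "j 1 \<notin> j ` {2..n}"
    using assms by (auto simp: B4_index_def)
  have "count (exponents n j m) (j 1) = m 1 - 1"
    using count_tail_word(2)[OF idx(2,3)] by (simp add: exponents_def)
  then have "count (exponents n j m) (j 1) < q \<longleftrightarrow> m 1 \<le> q"
    using idx(1) by auto
  moreover have "count (exponents n j m) (j i) = m i" if "i \<in> {2..n}" for i
  proof -
    have "j i \<noteq> j 1" using idx(3) that by (metis imageI)
    then show ?thesis using count_tail_word(1)[OF idx(2) that, of m] by (simp add: exponents_def)
  qed
  moreover have "count (exponents n j m) k = 0" if "k \<noteq> j 1" "k \<notin> j ` {2..n}" for k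
    using count_tail_word(2)[OF idx(2) that(2)] that by (simp add: exponents_def)
  ultimately show ?thesis
    using assms(2) by (metis imageE)
qed

lemma B4_index_surj:
  obtains n j m where "B4_index n j m" "j 1 = i" "exponents n j m = M"
proof -
  define R where "R = {#k \<in># M. k \<noteq> i#}"
  define xs where "xs = sorted_list_of_set (set_mset R)"
  define n where "n = Suc (length xs)"
  \<comment> \<open>The list \<open>xs\<close> is numbered from 0, but its entries occupy the
    positions from 2 on. Below, \<open>Suc\<close> restores the leading copy of
    \<open>i\<close>.\<close>
  define j where "j k = (if k = 1 then i else xs ! (k - 2))" for k
  define m where "m k = (if k = 1 then Suc (count M i) else count M (j k))" for k
  have xs: "set xs = set_mset R" "sorted_wrt (<) xs" by (simp_all add: xs_def)
  have j1: "j 1 = i" and m1: "m 1 = Suc (count M i)" by (simp_all add: j_def m_def)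
  have j2: "j (a + 2) = xs ! a" for a by (simp add: j_def)
  have idx: "{2..n} = (\<lambda>a. a + 2) ` {..<length xs}"
  proof (intro subset_antisym subsetI)
    fix k assume "k \<in> {2..n}"
    then have "k = (k - 2) + 2" "k - 2 < length xs" unfolding n_def atLeastAtMost_iff by arith+
    then show "k \<in> (\<lambda>a. a + 2) ` {..<length xs}" by blast
  qed (auto simp: n_def)
  have img: "j ` {2..n} = set_mset R"
    unfolding idx image_image j2 by (simp only: xs(1)[symmetric] set_conv_nth) blast
  have j_in: "j k \<in># R" if "k \<in> {2..n}" for k
    using img that by blast
  have mono: "strict_mono_on {2..n} j"
  proof (rule strict_mono_onI)
    fix a b assume "a \<in> {2..n}" "b \<in> {2..n}" "a < b"
    then obtain a' b' where "a = a' + 2" "b = b' + 2" "a' < b'" "b' < length xs"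
      unfolding idx by auto
    then show "j a < j b" using xs(2) by (simp only: j2 sorted_wrt_nth_less)
  qed
  have "B4_index n j m"
    unfolding B4_index_def
  proof (intro conjI ballI)
    show "1 \<le> n" by (simp add: n_def)
    show "strict_mono_on {2..n} j" by (rule mono)
    show "1 \<le> m k" if "k \<in> {1..n}" for k
      using that j_in[of k] by (cases "k = 1") (auto simp: m_def R_def)
    show "j 1 \<noteq> j k" if "k \<in> {2..n}" for k
      unfolding j1 using j_in[OF that] by (auto simp: R_def)
  qed
  moreover have "exponents n j m = M"
  proof (rule multiset_eqI)
    fix x
    have exp: "exponents n j m = replicate_mset (count M i) i + mset (tail_word n j m)"
      by (simp only: exponents_def j1 m1 diff_Suc_1)
    show "count (exponents n j m) x = count M x"
    proof (cases "x \<in> j ` {2..n}")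
      case True
      then obtain k where k: "k \<in> {2..n}" "x = j k" by blast
      have "x \<noteq> i" using True img by (auto simp: R_def)
      moreover have "m k = count M x" using k by (simp add: m_def)
      ultimately show ?thesis
        using count_tail_word(1)[OF mono k(1), of m] by (simp add: exp flip: k(2))
    next
      case False
      then have "x = i \<or> count M x = 0" using img by (auto simp: R_def not_in_iff)
      then show ?thesis using count_tail_word(2)[OF mono False, of m] by (auto simp: exp)
    qed
  qed
  ultimately show thesis using that j1 by blast
qed

lemma B4_eq: "B4 = range sorted_monomial"
proof (intro subset_antisym subsetI)
  fix f :: "'k::field free_leibniz" assume "f \<in> B4"
  then show "f \<in> range sorted_monomial" by (auto simp: B4_def power_monomial_eq)
next
  fix f :: "'k::field free_leibniz" assume "f \<in> range sorted_monomial"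
  then obtain i M where f: "f = sorted_monomial (i, M)" by auto
  obtain n j m where *: "B4_index n j m" "j 1 = i" "exponents n j m = M"
    by (rule B4_index_surj)
  have "f = power_monomial n j m" using f * by (simp add: power_monomial_eq)
  then show "f \<in> B4" using *(1) by (auto simp: B4_def)
qed

lemma B4_restricted_eq:
  assumes q: "0 < q"
  shows "(B4_restricted q :: 'k::field free_leibniz set) = sorted_monomial ` {(i, M). \<forall>k. count M k < q}"
proof (intro subset_antisym subsetI)
  fix f :: "'k::field free_leibniz" assume "f \<in> B4_restricted q"
  then obtain n j m where "f = power_monomial n j m" "B4_index n j m"
    "m 1 \<le> q" "\<forall>i\<in>{2..n}. m i < q"
    by (auto simp: B4_restricted_def)
  with exponents_less_iff[of n j m, OF _ q]
  show "f \<in> sorted_monomial ` {(i, M). \<forall>k. count M k < q}"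
    by (auto simp: power_monomial_eq)
next
  fix f :: "'k::field free_leibniz"
  assume "f \<in> sorted_monomial ` {(i, M). \<forall>k. count M k < q}"
  then obtain i M where f: "f = sorted_monomial (i, M)" "\<forall>k. count M k < q" by auto
  obtain n j m where *: "B4_index n j m" "j 1 = i" "exponents n j m = M"
    by (rule B4_index_surj)
  with f exponents_less_iff[of n j m, OF _ q] have "m 1 \<le> q" "\<forall>i\<in>{2..n}. m i < q" by auto
  moreover have "f = power_monomial n j m" using f * by (simp add: power_monomial_eq)
  ultimately show "f \<in> B4_restricted q" using *(1) by (auto simp: B4_restricted_def)
qed

section \<open>Bases of the relatively free algebras\<close>

lemma basis_in_relatively_free:
  "basis_in (relatively_free L) B \<longleftrightarrow> basis_in (quotient_space fl_scal UNIV (T_ideal L)) B"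
  by (simp add: basis_in_def independent_in_def span_in_def subspace_in_def relatively_free_def
      carrier_space.extend_def)

text \<open>By \<open>T\<close> the coefficient function is a coordinate on cosets, and it turns
  sorted monomials into the functions \<open>monomial_fun\<close>. A basis of the range of
  \<open>coeff_fun\<close> therefore pulls back to a basis of the quotient.\<close>

lemma images_form_basis_sorted_monomials:
  fixes L :: "('k::field, 'a::ab_group_add) algebra"
  assumes T: "T_ideal L = {f. coeff_fun f = 0}"
    and inj: "inj_on (monomial_fun :: _ \<Rightarrow> _ \<Rightarrow> 'k) X"
    and indep: "fun_space.independent ((monomial_fun :: _ \<Rightarrow> _ \<Rightarrow> 'k) ` X)"
    and span: "(monomial_fun :: _ \<Rightarrow> _ \<Rightarrow> 'k) ` X = range monomial_fun"
  shows "images_form_basis L (sorted_monomial ` X)"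
proof -
  let ?V = "quotient_space fl_scal UNIV (T_ideal L)"
  let ?\<psi> = "\<lambda>A :: 'k free_leibniz set. the_elem (coeff_fun ` A)"
  interpret V: coordinates fun_scal ?V ?\<psi>
    by (rule coeff_fun.coordinates_quotient) (simp_all add: T)
  have \<psi>: "?\<psi> (image_in_relfree L f) = coeff_fun f" for f
    by (subst coeff_fun.image_coset) (simp_all add: T coeff_fun.zero)
  have "inj_on (?\<psi> \<circ> image_in_relfree L) (sorted_monomial ` X)"
  proof (rule inj_onI)
    fix f g assume fg: "f \<in> sorted_monomial ` X" "g \<in> sorted_monomial ` X"
      "(?\<psi> \<circ> image_in_relfree L) f = (?\<psi> \<circ> image_in_relfree L) g"
    then obtain y z where yz: "y \<in> X" "f = sorted_monomial y" "z \<in> X" "g = sorted_monomial z"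
      by blast
    with fg(3) have "(monomial_fun y :: _ \<Rightarrow> 'k) = monomial_fun z"
      by (simp add: \<psi> coeff_fun_sorted_monomial)
    from inj_onD[OF inj this] yz show "f = g" by simp
  qed
  then have "inj_on (image_in_relfree L) (sorted_monomial ` X)"
    by (rule inj_on_imageI2)
  moreover have "basis_in ?V (image_in_relfree L ` sorted_monomial ` X)"
  proof (rule V.basis_in_iff[THEN iffD2])
    show "image_in_relfree L ` sorted_monomial ` X \<subseteq> carrier ?V"
      by (auto simp: quotient_space_def)
    have "?\<psi> ` image_in_relfree L ` sorted_monomial ` X = monomial_fun ` X"
      by (simp add: image_image \<psi> coeff_fun_sorted_monomial)
    moreover have "?\<psi> ` carrier ?V = range coeff_fun"
      by (simp add: quotient_space_def image_image \<psi>)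
    ultimately show "fun_space.independent (?\<psi> ` image_in_relfree L ` sorted_monomial ` X) \<and>
        fun_space.span (?\<psi> ` image_in_relfree L ` sorted_monomial ` X) = ?\<psi> ` carrier ?V"
      using indep by (simp add: span range_coeff_fun)
  qed
  ultimately show ?thesis by (simp add: images_form_basis_def basis_in_relatively_free)
qed

lemma images_form_basis_B4:
  fixes L :: "('k::field, 'a::ab_group_add) algebra"
  assumes "T_ideal L = {f. coeff_fun f = 0}" "infinite (UNIV :: 'k set)"
  shows "images_form_basis L B4"
  unfolding B4_eq
  by (intro images_form_basis_sorted_monomials assms(1) monomial_fun_independent)
    (simp_all add: assms(2))

lemma images_form_basis_B4_restricted:
  fixes L :: "('k::field, 'a::ab_group_add) algebra"
  assumes T: "T_ideal L = {f. coeff_fun f = 0}" and fin: "finite (UNIV :: 'k set)"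
  shows "images_form_basis L (B4_restricted (card (UNIV :: 'k set)))"
proof -
  define X where "X = {(i :: nat, M). \<forall>k :: nat. count M k < card (UNIV :: 'k set)}"
  \<comment> \<open>Lowering exponents by \<open>reduced_multiset\<close> shows that the reduced
    pairs already give every monomial function.\<close>
  have "monomial_fun z \<in> (monomial_fun :: _ \<Rightarrow> _ \<Rightarrow> 'k) ` X" for z
  proof -
    obtain i M where z: "z = (i, M)" by fastforce
    obtain M' where "\<And>k. count M' k < card (UNIV :: 'k set)"
      and "\<And>t :: nat \<Rightarrow> 'k. prod_mset (image_mset t M') = prod_mset (image_mset t M)"
      using reduced_multiset[OF fin] by blast
    then have "(monomial_fun z :: _ \<Rightarrow> 'k) = monomial_fun (i, M')" "(i, M') \<in> X"
      by (auto simp: z monomial_fun_def X_def)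
    then show ?thesis by blast
  qed
  then have "(monomial_fun :: _ \<Rightarrow> _ \<Rightarrow> 'k) ` X = range monomial_fun" by auto
  then have "images_form_basis L (sorted_monomial ` X)"
    by (intro images_form_basis_sorted_monomials T monomial_fun_independent) (auto simp: X_def)
  then show ?thesis
    by (simp add: B4_restricted_eq[OF finite_UNIV_card_ge_0[OF fin]] X_def)
qed

section \<open>Codimensions and exponents\<close>

lemma coeff_fun_multilinear:
  "coeff_fun ` multilinear n
    = fun_space.span ((\<lambda>i. monomial_fun (i, mset_set ({..<n} - {i})) :: _ \<Rightarrow> 'k::field) ` {..<n})"
proof -
  define W where "W = {w. distinct (leaves w) \<and> set (leaves w) = {..<n}}"
  have "coeff_fun ` multilinear n = fun_space.span (coeff_fun ` (monomial :: _ \<Rightarrow> 'k free_leibniz) ` W)"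
    by (simp only: multilinear_def W_def coeff_fun.span_image)
  also have "\<dots> = fun_space.span ((\<lambda>i. monomial_fun (i, mset_set ({..<n} - {i}))) ` {..<n})"
  proof (rule fun_space.span_eq[THEN iffD2], intro conjI subsetI)
    fix g assume "g \<in> coeff_fun ` (monomial :: _ \<Rightarrow> 'k free_leibniz) ` W"
    then obtain w where w: "w \<in> W" "g = coeff_fun (monomial w)" by blast
    show "g \<in> fun_space.span ((\<lambda>i. monomial_fun (i, mset_set ({..<n} - {i}))) ` {..<n})"
      using coeff_fun_monomial[where w = w and 'k = 'k]
    proof (elim disjE exE conjE)
      fix i ks assume ks: "leaves w = i # ks" "coeff_fun (monomial w) = (monomial_fun (i, mset ks) :: _ \<Rightarrow> 'k)"
      \<comment> \<open>Multilinearity forces \<open>ks\<close> to list every other letter once, so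
        only the leading letter is left to choose.\<close>
      have "distinct (i # ks)" "set (i # ks) = {..<n}" using w(1) ks(1) by (auto simp: W_def)
      then have "i < n" "set ks = {..<n} - {i}" "mset ks = mset_set (set ks)"
        by (auto simp: mset_set_set)
      then show ?thesis using w(2) ks(2) by (intro fun_space.span_base) auto
    qed (simp add: w fun_space.span_zero)
  next
    fix g assume "g \<in> (\<lambda>i. monomial_fun (i, mset_set ({..<n} - {i})) :: _ \<Rightarrow> 'k) ` {..<n}"
    then obtain i where i: "i < n" "g = monomial_fun (i, mset_set ({..<n} - {i}))" by auto
    define ks where "ks = sorted_list_of_set ({..<n} - {i})"
    have ks: "set ks = {..<n} - {i}" "distinct ks" by (simp_all add: ks_def)
    have "leaves (foldl Node (Letter i) (map Letter ks)) = i # ks" for ks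
      by (induction ks rule: rev_induct) auto
    moreover have "monomial (foldl Node (Letter i) (map Letter ks))
        = (left_normed (map var (i # ks)) :: 'k free_leibniz)" for ks
      by (induction ks rule: rev_induct) auto
    moreover have "mset ks = mset_set ({..<n} - {i})"
      using mset_set_set[OF ks(2)] by (simp only: ks(1))
    moreover have "distinct (i # ks)" "set (i # ks) = {..<n}"
      using i(1) ks by auto
    ultimately have "g = coeff_fun (monomial (foldl Node (Letter i) (map Letter ks)))"
      "foldl Node (Letter i) (map Letter ks) \<in> W"
      by (simp_all only: i(2) coeff_fun_left_normed W_def mem_Collect_eq simp_thms)
    then show "g \<in> fun_space.span (coeff_fun ` (monomial :: _ \<Rightarrow> 'k free_leibniz) ` W)"
      by (intro fun_space.span_base) blast
  qed
  finally show ?thesis .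
qed

text \<open>The quotient is isomorphic to the image of the multilinear space under
  \<open>coeff_fun\<close>, which has one basis function for each of the \<open>n\<close> possible
  leading letters.\<close>

lemma codim_eq:
  fixes L :: "('k::field, 'a::ab_group_add) algebra"
  assumes T: "T_ideal L = {f. coeff_fun f = 0}"
  shows "codim L n = n"
proof -
  let ?U = "multilinear n :: 'k free_leibniz set"
  let ?W = "?U \<inter> T_ideal L"
  let ?\<psi> = "\<lambda>A :: 'k free_leibniz set. the_elem (coeff_fun ` A)"
  have U: "fl.subspace ?U" by (simp add: multilinear_def)
  interpret V: coordinates fun_scal "quotient_space fl_scal ?U ?W" ?\<psi>
    by (rule coeff_fun.coordinates_quotient[OF U]) (simp add: T)
  have "?\<psi> (f +o ?W) = coeff_fun f" for f
    by (subst coeff_fun.image_coset) (auto simp: T coeff_fun.zero fl.subspace_0[OF U])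
  then have "?\<psi> ` carrier (quotient_space fl_scal ?U ?W) = coeff_fun ` ?U"
    by (simp add: quotient_space_def image_image)
  moreover define X where "X = (\<lambda>i. (i, mset_set ({..<n} - {i}))) ` {..<n}"
  \<comment> \<open>Multilinear exponents are 0 or 1, below the size of any finite field, so the
    field needs no case distinction.\<close>
  have "count M k < card (UNIV :: 'k set)"
    if "(i, M) \<in> X" "finite (UNIV :: 'k set)" for i M k
    using that two_le_card_field[OF that(2)] by (auto simp: X_def count_mset_set')
  note ind = monomial_fun_independent[where 'k = 'k, OF this]
  have "coeff_fun ` ?U = fun_space.span (monomial_fun ` X)"
    by (simp add: coeff_fun_multilinear X_def image_image)
  moreover have "card ((monomial_fun :: _ \<Rightarrow> _ \<Rightarrow> 'k) ` X) = n"
    using ind(1) by (simp add: card_image) (simp add: X_def card_image inj_on_def)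
  ultimately show ?thesis
    using ind(2) by (simp add: codim_def V.dim_in_eq fun_space.dim_eq_card_independent)
qed

lemma has_exponent_1:
  assumes "\<And>n. codim L n = n"
  shows "has_exponent L 1"
  unfolding has_exponent_def assms by (rule LIMSEQ_root)

theorem corollary3p19:
  shows "
    pi_equivalent (L11 :: ('k::field, 'k ^ 3) algebra) (LL4 :: ('k, 'k ^ 2) algebra) \<and>
    pi_equivalent (L11 :: ('k, 'k ^ 3) algebra) (N4 :: ('k, 'k ^ 3) algebra) \<and>
    pi_equivalent (L11 :: ('k, 'k ^ 3) algebra) (L10_0 :: ('k, 'k ^ 3) algebra) \<and>
    relatively_free (L11 :: ('k, 'k ^ 3) algebra) = relatively_free (LL4 :: ('k, 'k ^ 2) algebra) \<and>
    relatively_free (LL4 :: ('k, 'k ^ 2) algebra) = relatively_free (N4 :: ('k, 'k ^ 3) algebra) \<and>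
    relatively_free (N4 :: ('k, 'k ^ 3) algebra) = relatively_free (L10_0 :: ('k, 'k ^ 3) algebra) \<and>
    (infinite (UNIV :: 'k set) \<longrightarrow>
       images_form_basis (L11 :: ('k, 'k ^ 3) algebra) B4 \<and>
       images_form_basis (LL4 :: ('k, 'k ^ 2) algebra) B4 \<and>
       images_form_basis (N4 :: ('k, 'k ^ 3) algebra) B4 \<and>
       images_form_basis (L10_0 :: ('k, 'k ^ 3) algebra) B4) \<and>
    (\<forall>q. finite (UNIV :: 'k set) \<and> card (UNIV :: 'k set) = q \<longrightarrow>
       images_form_basis (L11 :: ('k, 'k ^ 3) algebra) (B4_restricted q) \<and>
       images_form_basis (LL4 :: ('k, 'k ^ 2) algebra) (B4_restricted q) \<and>
       images_form_basis (N4 :: ('k, 'k ^ 3) algebra) (B4_restricted q) \<and>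
       images_form_basis (L10_0 :: ('k, 'k ^ 3) algebra) (B4_restricted q)) \<and>
    (\<forall>n\<ge>1.
       codim (L11 :: ('k, 'k ^ 3) algebra) n = n \<and>
       codim (LL4 :: ('k, 'k ^ 2) algebra) n = n \<and>
       codim (N4 :: ('k, 'k ^ 3) algebra) n = n \<and>
       codim (L10_0 :: ('k, 'k ^ 3) algebra) n = n) \<and>
    has_exponent (L11 :: ('k, 'k ^ 3) algebra) 1 \<and>
    has_exponent (LL4 :: ('k, 'k ^ 2) algebra) 1 \<and>
    has_exponent (N4 :: ('k, 'k ^ 3) algebra) 1 \<and>
    has_exponent (L10_0 :: ('k, 'k ^ 3) algebra) 1"
proof -
  have T: "T_ideal (L11 :: ('k, 'k ^ 3) algebra) = {f. coeff_fun f = 0}"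
    "T_ideal (LL4 :: ('k, 'k ^ 2) algebra) = {f. coeff_fun f = 0}"
    "T_ideal (N4 :: ('k, 'k ^ 3) algebra) = {f. coeff_fun f = 0}"
    "T_ideal (L10_0 :: ('k, 'k ^ 3) algebra) = {f. coeff_fun f = 0}"
    by (rule projection_algebra.T_ideal_eq, rule projection_algebra_L11 projection_algebra_LL4
        projection_algebra_N4 projection_algebra_L10_0)+
  \<comment> \<open>\<open>relatively_free L\<close> depends on \<open>L\<close> only through
    \<open>T_ideal L\<close>, so equal T-ideals give equal algebras, not just isomorphic
    ones.\<close>
  show ?thesis
    using T[THEN images_form_basis_B4] T[THEN images_form_basis_B4_restricted] T[THEN codim_eq]
      T[THEN codim_eq, THEN has_exponent_1]
    by (simp add: pi_equivalent_def relatively_free_def T)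
qed

end
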